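(* Let $D$ be a star-shaped origin-symmetric domain in $\mathbb{C}^n$, let $G_{1,n}$ be the set of $1$-dimensional complex vector subspaces of $\mathbb{C}^n$, that is, the (Grassmannian) set of complex lines through the origin, and let $d\ell$ be the standard probability measure on $G_{1,n}$. Then: (1) $$\mathrm{vol}(D) \ \ge\ \frac{1}{n!}\int_{\ell\in G_{1,n}} \bigl(\mathrm{area}(D\cap \ell)\bigr)^n\, d\ell .$$ (2) $$\mathrm{vol}(D) = \frac{1}{n!}\int_{\ell\in G_{1,n}} \bigl(\mathrm{area}(D\cap \ell)\bigr)^n\, d\ell$$ precisely when $D$ is circular.
   Context: Identify $\mathbb{C}^n$ with $\mathbb{R}^{2n}$ with its Euclidean structure. $\mathrm{vol}$ is $2n$-dimensional Lebesgue measure; for a complex line $\ell$ through the origin, regarded as a real $2$-plane, $\mathrm{area}$ is the $2$-dimensional Lebesgue measure on $\ell$ induced by the Euclidean metric. The standard probability measure on $G_{1,n}$ is the one invariant under the unitary group $U(n)$. Star-shaped means star-shaped with respect to the origin: $tz\in D$ for all $z\in D$ and $t\in[0,1]$. Origin-symmetric means $D=-D$. A domain $D$ is circular (with center the origin) if $e^{i\theta}z\in D$ for all $z\in D$ and all $\theta\in\mathbb{R}$.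
   Formalization: "Equality only if D is circular" fails for n=1, infinite volume, or a ball minus two opposite radial segments; it is stated for n≥2 and vol(D) finite: equality iff D is circular up to null sets, and iff D is circular when D is the interior of its closure. *)

theory Defs
  imports "HOL-Probability.Probability"
begin

text \<open>Multiplication by a complex scalar on \<^typ>\<open>complex ^ 'n\<close> is \<open>*s\<close>; the operator \<open>*\<^sub>R\<close>, the norm and
  the measure \<^const>\<open>lborel\<close> refer to its underlying real Euclidean structure, of real dimension
  \<open>2 * CARD('n)\<close>.\<close>

definition complex_domain :: "(complex ^ 'n) set \<Rightarrow> bool" where
  "complex_domain D \<longleftrightarrow> open D \<and> connected D \<and> D \<noteq> {}"

definition star_shaped :: "(complex ^ 'n) set \<Rightarrow> bool" where
  "star_shaped D \<longleftrightarrow> (\<forall>z\<in>D. \<forall>t\<in>{0..1::real}. t *\<^sub>R z \<in> D)"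

definition origin_symmetric :: "(complex ^ 'n) set \<Rightarrow> bool" where
  "origin_symmetric D \<longleftrightarrow> D = uminus ` D"

definition circular :: "(complex ^ 'n) set \<Rightarrow> bool" where
  "circular D \<longleftrightarrow> (\<forall>z\<in>D. \<forall>\<theta>::real. cis \<theta> *s z \<in> D)"

text \<open>The volume and the section areas only see \<open>D\<close> up to null sets: removing from the unit ball the
  two rays \<open>t *\<^sub>R u\<close> and \<open>- t *\<^sub>R u\<close>, where \<open>norm u = 1\<close> and \<open>t \<ge> 1/2\<close>, leaves a star-shaped
  origin-symmetric domain that is not circular but has the volume and the section areas of the ball.
  For arbitrary domains the equality case is therefore circularity modulo null sets; for domains
  with \<open>interior (closure D) = D\<close> this is the same as circularity. Equality carries no information in
  complex dimension 1, nor if both sides are infinite, as for the domain \<open>\<bar>Re (z $ i)\<bar> < 1\<close>.\<close>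

definition circular_ae :: "(complex ^ 'n) set \<Rightarrow> bool" where
  "circular_ae D \<longleftrightarrow>
     (\<forall>\<theta>::real. sym_diff D ((\<lambda>z. cis \<theta> *s z) ` D) \<in> null_sets lborel)"

definition complex_lines :: "(complex ^ 'n) set set" where
  "complex_lines = {L. vec.subspace L \<and> vec.dim L = 1}"

text \<open>Two-dimensional Lebesgue measure on a real 2-plane \<open>P\<close> through the origin, transported from the
  Euclidean plane \<^typ>\<open>complex\<close> along a linear isometry onto \<open>P\<close>. The choice of isometry is
  immaterial, since any two differ by an orthogonal map of the Euclidean plane.\<close>

definition plane_area :: "'a::euclidean_space set \<Rightarrow> 'a set \<Rightarrow> ennreal" where
  "plane_area P A = emeasure lborel
     ((SOME f :: complex \<Rightarrow> 'a. linear f \<and> (\<forall>x. norm (f x) = norm x) \<and> range f = P) -` A)"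

definition unitary :: "complex ^ 'n ^ 'n \<Rightarrow> bool" where
  "unitary U \<longleftrightarrow> (\<chi> i j. cnj (U $ j $ i)) ** U = mat 1"

text \<open>Open sets for the quotient topology on the Grassmannian: \<open>\<Union>V - {0}\<close> is the preimage of a set
  \<open>V\<close> of lines under the projection sending a nonzero vector to the line it spans.\<close>

definition grassmann_open :: "(complex ^ 'n) set set \<Rightarrow> bool" where
  "grassmann_open V \<longleftrightarrow> V \<subseteq> complex_lines \<and> open (\<Union>V - {0})"

definition unitary_invariant_prob :: "(complex ^ 'n) set measure \<Rightarrow> bool" where
  "unitary_invariant_prob M \<longleftrightarrow>
     prob_space M \<and> space M = complex_lines \<and>
     sets M = sigma_sets complex_lines {V. grassmann_open V} \<and>
     (\<forall>U A. unitary U \<longrightarrow> A \<in> sets M \<longrightarrow> emeasure M ((\<lambda>L. (*v) U ` L) ` A) = emeasure M A)"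

definition grassmann_measure :: "(complex ^ 'n) set measure" where
  "grassmann_measure = (THE M. unitary_invariant_prob M)"

end

theory Submission
  imports Defs
begin

text \<open>For a unit vector \<open>u\<close> let \<open>E\<close> be the section \<open>{c. c *s u \<in> D}\<close> of \<open>D\<close> by the line of \<open>u\<close>, a subset of
  the plane, and let \<open>n\<close> be the complex dimension. Up to one and the same constant, the volume of \<open>D\<close> is
  the average over \<open>u\<close> of the integral of \<open>\<bar>c\<bar> ^ (2 * n - 2)\<close> over \<open>E\<close>. Among plane sets of given
  area, this integral is least for the disc centred at the origin, where it is a multiple of the
  \<open>n\<close>-th power of the area; this is the inequality. Equality forces almost all sections to be discs up
  to null sets, which means that \<open>D\<close> is circular up to null sets. The invariant measure on the
  Grassmannian is identified with the image of the uniform measure on the unit ball by the theorem that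
  two probability measures on a metric space agree when for each of them the measure of
  a ball centred in its support depends only on the radius.\<close>

subsection \<open>Isometries and Lebesgue measure\<close>

text \<open>Surface measure on the sphere is avoided: a direction is \<open>sgn z\<close> for a
  point \<open>z\<close> of the unit ball, and "almost every line" means "almost every
  \<open>z\<close>". The factor 1 / n! in the theorem is tied to the volume pi^n / n! of that ball:
  the factorials cancel, and each section enters through area / pi, the squared radius of the disc
  of equal area. Star-shapedness makes a rotation invariant section a disc instead of a union of
  annuli. The weight is constant for n = 1 and strictly increasing in the modulus for n at least 2,
  where equality becomes rigid; finite volume turns equality of two integrals into almost everywhere
  equality of their integrands. For the converse, a domain that is circular up to a null set is
  enlarged by a null set to an honestly circular one. The Grassmannian measure enters through
  \<open>THE\<close>, so both existence and uniqueness have to be proved; uniqueness rests only on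
  the fact that unitary maps act transitively on lines and isometrically on the projections onto
  them.\<close>

lemma nn_integral_lborel_translate:
  fixes f :: "'a::euclidean_space \<Rightarrow> ennreal"
  assumes [measurable]: "f \<in> borel_measurable borel"
  shows "(\<integral>\<^sup>+x. f (x + a) \<partial>lborel) = (\<integral>\<^sup>+x. f x \<partial>lborel)"
proof -
  have "(\<integral>\<^sup>+x. f x \<partial>lborel) = (\<integral>\<^sup>+x. f x \<partial>distr lborel borel ((+) a))"
    by (simp add: lborel_distr_plus)
  also have "\<dots> = (\<integral>\<^sup>+x. f (x + a) \<partial>lborel)"
    by (subst nn_integral_distr) (auto simp: add.commute)
  finally show ?thesis by simp
qed

lemma sets_borel_ball [measurable, simp]: "ball (x::'a::metric_space) r \<in> sets borel"
  by simp

lemma emeasure_unit_ball: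
  "emeasure lborel (ball (0::'a::euclidean_space) 1) \<noteq> 0"
  "emeasure lborel (ball (0::'a::euclidean_space) 1) \<noteq> \<infinity>"
  using unit_ball_vol_pos[of "real DIM('a)"]
  by (simp_all add: emeasure_ball del: unit_ball_vol_pos)

text \<open>Both sides arise from \<open>\<integral>\<integral> 1\<^sub>U x * 1\<^sub>A (x + f y) dx dy\<close>, \<open>U\<close> the unit ball,
  by translating in one variable or in the other.\<close>

lemma lborel_distr_linear_isometry:
  fixes f :: "'a::euclidean_space \<Rightarrow> 'a"
  assumes f: "linear f" and nf: "\<And>x. norm (f x) = norm x"
  shows "distr lborel borel f = lborel"
proof (rule measure_eqI)
  have [measurable]: "f \<in> borel_measurable borel"
    using linear_continuous_on[OF linear_conv_bounded_linear[THEN iffD1, OF f]]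
    by (rule borel_measurable_continuous_onI)
  have surj: "surj f"
    using orthogonal_transformation_surj[of f] f nf by (simp add: orthogonal_transformation)
  define U where "U = ball (0::'a) 1"
  have [measurable]: "U \<in> sets borel" by (simp add: U_def)
  have U: "emeasure lborel U \<noteq> \<infinity>" "emeasure lborel U \<noteq> 0"
    unfolding U_def using emeasure_unit_ball by auto
  fix A assume "A \<in> sets (distr lborel borel f)"
  then have [measurable]: "A \<in> sets borel" by simp
  let ?iA = "indicator A :: 'a \<Rightarrow> ennreal" and ?iU = "indicator U :: 'a \<Rightarrow> ennreal"
  have "emeasure lborel U * emeasure (distr lborel borel f) A
      = (\<integral>\<^sup>+x. ?iU x \<partial>lborel) * (\<integral>\<^sup>+y. ?iA (f y) \<partial>lborel)"
    by (simp add: nn_integral_distr flip: nn_integral_indicator)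
  also have "\<dots> = (\<integral>\<^sup>+x. ?iU x * (\<integral>\<^sup>+y. ?iA (f y) \<partial>lborel) \<partial>lborel)"
    by (simp add: nn_integral_multc)
  also have "\<dots> = (\<integral>\<^sup>+x. ?iU x * (\<integral>\<^sup>+y. ?iA (f y + x) \<partial>lborel) \<partial>lborel)"
  proof (rule nn_integral_cong)
    fix x
    obtain b where b: "x = f b" using surj by (auto simp: surj_def)
    show "?iU x * (\<integral>\<^sup>+y. ?iA (f y) \<partial>lborel) = ?iU x * (\<integral>\<^sup>+y. ?iA (f y + x) \<partial>lborel)"
      using nn_integral_lborel_translate[of "\<lambda>y. ?iA (f y)" b]
      by (simp add: b linear_add[OF f])
  qed
  also have "\<dots> = (\<integral>\<^sup>+x. \<integral>\<^sup>+y. ?iU x * ?iA (f y + x) \<partial>lborel \<partial>lborel)"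
    by (simp add: nn_integral_cmult)
  also have "\<dots> = (\<integral>\<^sup>+y. \<integral>\<^sup>+x. ?iU x * ?iA (f y + x) \<partial>lborel \<partial>lborel)"
    by (rule lborel_pair.Fubini') simp
  also have "\<dots> = (\<integral>\<^sup>+y. \<integral>\<^sup>+x. ?iU (x - f y) * ?iA x \<partial>lborel \<partial>lborel)"
  proof (rule nn_integral_cong)
    fix y
    show "(\<integral>\<^sup>+x. ?iU x * ?iA (f y + x) \<partial>lborel) = (\<integral>\<^sup>+x. ?iU (x - f y) * ?iA x \<partial>lborel)"
      using nn_integral_lborel_translate[of "\<lambda>x. ?iU (x - f y) * ?iA x" "f y"]
      by (simp add: add.commute)
  qed
  also have "\<dots> = (\<integral>\<^sup>+x. \<integral>\<^sup>+y. ?iU (x - f y) * ?iA x \<partial>lborel \<partial>lborel)"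
    by (rule lborel_pair.Fubini') simp
  also have "\<dots> = (\<integral>\<^sup>+x. (\<integral>\<^sup>+y. ?iU (x - f y) \<partial>lborel) * ?iA x \<partial>lborel)"
    by (simp add: nn_integral_multc)
  also have "\<dots> = (\<integral>\<^sup>+x. emeasure lborel U * ?iA x \<partial>lborel)"
  proof (rule nn_integral_cong)
    fix x
    obtain b where b: "x = f b" using surj by (auto simp: surj_def)
    have "?iU (x - f y) = ?iU (y + - b)" for y
      by (simp add: U_def b indicator_def nf norm_minus_commute flip: linear_diff[OF f])
    then show "(\<integral>\<^sup>+y. ?iU (x - f y) \<partial>lborel) * ?iA x = emeasure lborel U * ?iA x"
      using nn_integral_lborel_translate[of ?iU "- b"] by simp
  qed
  also have "\<dots> = emeasure lborel U * emeasure lborel A"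
    by (simp add: nn_integral_cmult)
  finally show "emeasure (distr lborel borel f) A = emeasure lborel A"
    using U by (simp add: ennreal_mult_cancel_left)
qed simp

text \<open>A linear similarity is a linear isometry followed by the homothety of ratio
  \<open>r\<close>, and only the homothety changes volume. Multiplication by a complex scalar is the
  instance used, both on the plane and on the whole space.\<close>

lemma nn_integral_lborel_similarity:
  fixes f :: "'a::euclidean_space \<Rightarrow> 'a" and g :: "'a \<Rightarrow> ennreal"
  assumes f: "linear f" and nf: "\<And>x. norm (f x) = r * norm x" and r: "r > 0"
    and [measurable]: "g \<in> borel_measurable borel"
  shows "(\<integral>\<^sup>+x. g x \<partial>lborel) = ennreal (r ^ DIM('a)) * (\<integral>\<^sup>+x. g (f x) \<partial>lborel)"
proof -
  define h where "h = (\<lambda>x. (1 / r) *\<^sub>R f x)"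
  have "linear h" unfolding h_def using f by (rule linear_compose_scale_right)
  moreover have "norm (h x) = norm x" for x using r by (simp add: h_def nf)
  ultimately have D: "distr lborel borel h = lborel" by (rule lborel_distr_linear_isometry)
  have [measurable]: "f \<in> borel_measurable borel"
    using linear_continuous_on[OF linear_conv_bounded_linear[THEN iffD1, OF f]]
    by (rule borel_measurable_continuous_onI)
  have [measurable]: "h \<in> borel_measurable borel" unfolding h_def by simp
  have "(\<integral>\<^sup>+x. g x \<partial>lborel) = ennreal (r ^ DIM('a)) * (\<integral>\<^sup>+x. g (r *\<^sub>R x) \<partial>lborel)"
    using r by (subst lborel_affine[of r 0]) (simp_all add: nn_integral_density nn_integral_distr nn_integral_cmult)
  also have "(\<integral>\<^sup>+x. g (r *\<^sub>R x) \<partial>lborel) = (\<integral>\<^sup>+x. g (f x) \<partial>lborel)"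
    using r by (subst D[symmetric], subst nn_integral_distr) (simp_all add: h_def)
  finally show ?thesis .
qed

subsection \<open>Integration along complex lines\<close>

lemma norm_vector_smult: "norm (c *s (z :: complex ^ 'n)) = norm c * norm z"
  by (simp add: norm_vec_def norm_mult L2_set_right_distrib)

lemma vector_smult_of_real: "complex_of_real r *s (z :: complex ^ 'n) = r *\<^sub>R z"
  by (simp add: vec_eq_iff) (simp add: scaleR_conv_of_real)

lemma continuous_on_vector_smult [continuous_intros]:
  fixes g :: "'a::topological_space \<Rightarrow> complex ^ 'n"
  shows "continuous_on S f \<Longrightarrow> continuous_on S g \<Longrightarrow> continuous_on S (\<lambda>x. f x *s g x)"
  unfolding vector_scalar_mult_def by (intro continuous_intros)

lemma measurable_vector_smult [measurable (raw)]:
  fixes g :: "'a \<Rightarrow> complex ^ 'n"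
  assumes [measurable]: "f \<in> borel_measurable M" "g \<in> borel_measurable M"
  shows "(\<lambda>x. f x *s g x) \<in> borel_measurable M"
proof -
  have "(\<lambda>(c, z :: complex ^ 'n). c *s z) \<in> borel_measurable (borel \<Otimes>\<^sub>M borel)"
    unfolding case_prod_beta borel_prod by (intro borel_measurable_continuous_onI continuous_intros)
  from measurable_compose[OF _ this, of "\<lambda>x. (f x, g x)" M] show ?thesis by simp
qed

lemma linear_vector_smult_left: "linear (\<lambda>c. c *s (z :: complex ^ 'n))"
  by (rule linearI) (simp_all add: vec_eq_iff distrib_right)

lemma linear_vector_smult_right: "linear (\<lambda>z :: complex ^ 'n. c *s z)"
  by (rule linearI) (simp_all add: vec_eq_iff distrib_left)

text \<open>In real dimension 2n the radial density is r^(2n-1) dr; the area element of a complex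
  line already accounts for r dr, which leaves the weight r^(2n-2).\<close>

definition weighted_area :: "nat \<Rightarrow> complex set \<Rightarrow> ennreal" where
  "weighted_area n E = (\<integral>\<^sup>+c. ennreal (norm c ^ (2 * n - 2)) * indicator E c \<partial>lborel)"

lemma power2_mult_power: "n \<ge> 1 \<Longrightarrow> x\<^sup>2 * x ^ (2 * n - 2) = (x :: real) ^ (2 * n)"
  using power_add[of x 2 "2 * n - 2"] by (simp only: le_add_diff_inverse mult_le_mono2[of 1 n 2, simplified])

text \<open>Fubini with a scaling in each variable. Rescaling \<open>c\<close> replaces
  \<open>sgn z\<close> by \<open>z\<close>; for fixed \<open>c\<close> the variable
  \<open>c *s z\<close> is then taken as the new point of the space, so that the ball becomes the
  condition that its norm is below \<open>norm c\<close>. Swapping back, the integral over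
  \<open>c\<close> is a constant times a power of the norm that cancels the powers collected
  before.\<close>

lemma nn_integral_complex_lines_aux:
  fixes f :: "complex ^ 'n \<Rightarrow> ennreal"
  assumes [measurable]: "f \<in> borel_measurable borel"
  shows "(\<integral>\<^sup>+z. indicator (ball 0 1) z *
       (\<integral>\<^sup>+c. ennreal (norm c ^ (2 * CARD('n) - 2)) * f (c *s sgn z) \<partial>lborel) \<partial>lborel)
     = (\<integral>\<^sup>+c. ennreal (indicator {c. norm c > 1} c / norm c ^ (2 * CARD('n) + 2)) \<partial>(lborel :: complex measure))
         * (\<integral>\<^sup>+z. f z \<partial>lborel)"
proof -
  let ?n = "CARD('n)"
  have n: "?n \<ge> 1" by (simp add: Suc_leI)
  have dim: "DIM(complex ^ 'n) = 2 * ?n" by simp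
  let ?B = "indicator (ball 0 1) :: complex ^ 'n \<Rightarrow> ennreal"
  have [measurable, simp]: "ball (0 :: complex ^ 'n) 1 \<in> sets borel" by simp
  define k where "k = (\<lambda>c::complex. ennreal (norm c ^ (2 * ?n - 2)))"
  have [measurable]: "k \<in> borel_measurable borel" by (simp add: k_def)
  define K' where "K' = (\<integral>\<^sup>+c. ennreal (indicator {c. norm c > 1} c / norm c ^ (2 * ?n + 2)) \<partial>(lborel :: complex measure))"
  have [measurable]: "(sgn :: complex ^ 'n \<Rightarrow> _) \<in> borel_measurable borel"
    unfolding sgn_div_norm by measurable
  have 1: "(\<integral>\<^sup>+c. k c * f (c *s sgn z) \<partial>lborel)
       = ennreal (norm z ^ (2 * ?n)) * (\<integral>\<^sup>+c. k c * f (c *s z) \<partial>lborel)" if z: "z \<noteq> 0" for z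
  proof -
    have "(\<integral>\<^sup>+c. k c * f (c *s sgn z) \<partial>lborel)
        = ennreal (norm z ^ 2) * (\<integral>\<^sup>+c. k (of_real (norm z) * c) * f ((of_real (norm z) * c) *s sgn z) \<partial>lborel)"
      using nn_integral_lborel_similarity[of "\<lambda>c. of_real (norm z) * c" "norm z" "\<lambda>c. k c * f (c *s sgn z)"] z
      by (simp add: bounded_linear_mult_right bounded_linear.linear norm_mult DIM_complex)
    also have "(\<lambda>c. f ((of_real (norm z) * c) *s sgn z)) = (\<lambda>c. f (c *s z))"
    proof
      fix c
      have "(of_real (norm z) * c) *s sgn z = c *s (of_real (norm z) *s sgn z)"
        by (simp add: vec_eq_iff mult_ac)
      then show "f ((of_real (norm z) * c) *s sgn z) = f (c *s z)"
        using z by (simp add: vector_smult_of_real sgn_div_norm)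
    qed
    then have "(\<lambda>c. k (of_real (norm z) * c) * f ((of_real (norm z) * c) *s sgn z))
        = (\<lambda>c. ennreal (norm z ^ (2 * ?n - 2)) * (k c * f (c *s z)))"
      by (auto simp: fun_eq_iff k_def norm_mult power_mult_distrib ennreal_mult mult_ac)
    also have "ennreal (norm z ^ 2) * (\<integral>\<^sup>+c. ennreal (norm z ^ (2 * ?n - 2)) * (k c * f (c *s z)) \<partial>lborel)
       = (ennreal (norm z ^ 2) * ennreal (norm z ^ (2 * ?n - 2))) * (\<integral>\<^sup>+c. k c * f (c *s z) \<partial>lborel)"
      by (simp add: nn_integral_cmult mult.assoc)
    also have "ennreal (norm z ^ 2) * ennreal (norm z ^ (2 * ?n - 2)) = ennreal (norm z ^ (2 * ?n))"
      by (simp add: power2_mult_power[OF n] flip: ennreal_mult)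
    finally show ?thesis .
  qed
  \<comment> \<open>The exponent 4n has two halves: the Jacobian of multiplication by
    \<open>c\<close>, and the factor \<open>norm z ^ (2 * ?n)\<close> rewritten in the new
    variable.\<close>
  have 2: "(\<integral>\<^sup>+z. ?B z * ennreal (norm z ^ (2 * ?n)) * f (c *s z) \<partial>lborel)
     = (\<integral>\<^sup>+z. ennreal (1 / norm c ^ (4 * ?n)) * ennreal (norm z ^ (2 * ?n)) * f z * indicator {z. norm z < norm c} z \<partial>lborel)"
    if c: "c \<noteq> 0" for c
  proof -
    have "(\<integral>\<^sup>+z. ennreal (1 / norm c ^ (4 * ?n)) * ennreal (norm z ^ (2 * ?n)) * f z * indicator {z. norm z < norm c} z \<partial>lborel)
      = ennreal (norm c ^ (2 * ?n)) * (\<integral>\<^sup>+z. ennreal (1 / norm c ^ (4 * ?n)) * ennreal (norm (c *s z) ^ (2 * ?n)) * f (c *s z) * indicator {z. norm z < norm c} (c *s z) \<partial>lborel)"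
      unfolding dim[symmetric] using c
      by (intro nn_integral_lborel_similarity[OF linear_vector_smult_right]) (auto simp: norm_vector_smult)
    also have "\<dots> = (\<integral>\<^sup>+z. ?B z * ennreal (norm z ^ (2 * ?n)) * f (c *s z) \<partial>lborel)"
    proof (subst nn_integral_cmult[symmetric], measurable, intro nn_integral_cong)
      fix z :: "complex ^ 'n"
      have "ennreal (norm c ^ (2 * ?n)) * (ennreal (1 / norm c ^ (4 * ?n)) * ennreal (norm (c *s z) ^ (2 * ?n)))
          = ennreal (norm c ^ (2 * ?n) * (1 / norm c ^ (4 * ?n) * norm (c *s z) ^ (2 * ?n)))"
        by (simp flip: ennreal_mult)
      also have "norm c ^ (2 * ?n) * (1 / norm c ^ (4 * ?n) * norm (c *s z) ^ (2 * ?n)) = norm z ^ (2 * ?n)"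
      proof -
        have "norm c ^ (4 * ?n) = norm c ^ (2 * ?n) * norm c ^ (2 * ?n)" by (simp flip: power_add)
        then show ?thesis using c by (simp add: norm_vector_smult power_mult_distrib)
      qed
      finally show "ennreal (norm c ^ (2 * ?n)) * (ennreal (1 / norm c ^ (4 * ?n)) * ennreal (norm (c *s z) ^ (2 * ?n)) * f (c *s z) * indicator {z. norm z < norm c} (c *s z))
          = ?B z * ennreal (norm z ^ (2 * ?n)) * f (c *s z)"
        using c by (auto simp: norm_vector_smult indicator_def mult_ac)
    qed
    finally show ?thesis by simp
  qed
  \<comment> \<open>Scaling \<open>c\<close> by \<open>norm z\<close> collects the exponent 2 + (2n
    - 2) - 4n = -2n, which cancels the factor \<open>norm z ^ (2 * ?n)\<close> left by the previous
    substitution.\<close>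
  have 3: "(\<integral>\<^sup>+c. k c * ennreal (1 / norm c ^ (4 * ?n)) * indicator {c. norm z < norm c} c \<partial>lborel)
     = ennreal (1 / norm z ^ (2 * ?n)) * K'" if z: "z \<noteq> 0" for z :: "complex ^ 'n"
  proof -
    have "(\<integral>\<^sup>+c. k c * ennreal (1 / norm c ^ (4 * ?n)) * indicator {c. norm z < norm c} c \<partial>lborel)
       = ennreal (norm z ^ 2) * (\<integral>\<^sup>+c. k (of_real (norm z) * c) * ennreal (1 / norm (of_real (norm z) * c) ^ (4 * ?n)) * indicator {c. norm z < norm c} (of_real (norm z) * c) \<partial>lborel)"
      using nn_integral_lborel_similarity[of "\<lambda>c. of_real (norm z) * c" "norm z" "\<lambda>c. k c * ennreal (1 / norm c ^ (4 * ?n)) * indicator {c. norm z < norm c} c"] z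
      by (simp add: bounded_linear_mult_right bounded_linear.linear norm_mult DIM_complex)
    also have "\<dots> = (\<integral>\<^sup>+c. ennreal (norm z ^ 2) * (k (of_real (norm z) * c) * ennreal (1 / norm (of_real (norm z) * c) ^ (4 * ?n)) * indicator {c. norm z < norm c} (of_real (norm z) * c)) \<partial>lborel)"
      by (rule nn_integral_cmult[symmetric]) simp
    also have "\<dots> = (\<integral>\<^sup>+c. ennreal (1 / norm z ^ (2 * ?n)) * ennreal (indicator {c. norm c > 1} c / norm c ^ (2 * ?n + 2)) \<partial>(lborel :: complex measure))"
    proof (rule nn_integral_cong)
      fix c :: complex
      let ?r = "norm z" and ?s = "norm c"
      show "ennreal (norm z ^ 2) * (k (of_real (norm z) * c) * ennreal (1 / norm (of_real (norm z) * c) ^ (4 * ?n)) * indicator {c. norm z < norm c} (of_real (norm z) * c))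
        = ennreal (1 / norm z ^ (2 * ?n)) * ennreal (indicator {c. norm c > 1} c / norm c ^ (2 * ?n + 2))"
      proof (cases "?s > 1")
        case True
        have "?r\<^sup>2 * (?r * ?s) ^ (2 * ?n - 2) / (?r * ?s) ^ (4 * ?n) = 1 / ?r ^ (2 * ?n) * (1 / ?s ^ (2 * ?n + 2))"
        proof -
          have pos: "?s > 0" "?r > 0" using True z by auto
          define t where "t = ?r * ?s"
          have "t > 0" using pos by (simp add: t_def)
          have e1: "t ^ (4 * ?n) = t ^ (2 * ?n - 2) * t ^ (2 * ?n + 2)"
          proof -
            have "4 * ?n = (2 * ?n - 2) + (2 * ?n + 2)" using n by linarith
            then show ?thesis by (simp only: power_add)
          qed
          have e2: "?r ^ (2 * ?n + 2) = ?r\<^sup>2 * ?r ^ (2 * ?n)"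
            by (simp add: power_add power2_eq_square)
          have "?r\<^sup>2 * t ^ (2 * ?n - 2) / t ^ (4 * ?n) = ?r\<^sup>2 / t ^ (2 * ?n + 2)"
            unfolding e1 using \<open>t > 0\<close> by simp
          also have "\<dots> = 1 / ?r ^ (2 * ?n) * (1 / ?s ^ (2 * ?n + 2))"
            unfolding t_def power_mult_distrib e2 using pos by simp
          finally show ?thesis by (simp only: t_def)
        qed
        then show ?thesis using True z
          by (simp add: k_def norm_mult indicator_def flip: ennreal_mult ennreal_mult')
      qed (use z in \<open>auto simp: indicator_def norm_mult\<close>)
    qed
    also have "\<dots> = ennreal (1 / norm z ^ (2 * ?n)) * K'"
      by (simp add: nn_integral_cmult K'_def)
    finally show ?thesis .
  qed
  have "(\<integral>\<^sup>+z. ?B z * (\<integral>\<^sup>+c. k c * f (c *s sgn z) \<partial>lborel) \<partial>lborel)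
     = (\<integral>\<^sup>+z. \<integral>\<^sup>+c. k c * (?B z * ennreal (norm z ^ (2 * ?n)) * f (c *s z)) \<partial>lborel \<partial>lborel)"
  proof (rule nn_integral_cong_AE)
    show "AE z in lborel. ?B z * (\<integral>\<^sup>+c. k c * f (c *s sgn z) \<partial>lborel)
        = (\<integral>\<^sup>+c. k c * (?B z * ennreal (norm z ^ (2 * ?n)) * f (c *s z)) \<partial>lborel)"
      using AE_lborel_singleton[of 0]
      by eventually_elim (simp add: 1 mult_ac flip: nn_integral_cmult)
  qed
  also have "\<dots> = (\<integral>\<^sup>+c. \<integral>\<^sup>+z. k c * (?B z * ennreal (norm z ^ (2 * ?n)) * f (c *s z)) \<partial>lborel \<partial>lborel)"
    by (rule lborel_pair.Fubini') simp
  also have "\<dots> = (\<integral>\<^sup>+c. \<integral>\<^sup>+z. k c * ennreal (1 / norm c ^ (4 * ?n)) * indicator {c. norm z < norm c} c * (ennreal (norm z ^ (2 * ?n)) * f z) \<partial>lborel \<partial>lborel)"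
  proof (rule nn_integral_cong_AE)
    show "AE c in lborel. (\<integral>\<^sup>+z. k c * (?B z * ennreal (norm z ^ (2 * ?n)) * f (c *s z)) \<partial>lborel) =
      (\<integral>\<^sup>+z. k c * ennreal (1 / norm c ^ (4 * ?n)) * indicator {c. norm z < norm c} c * (ennreal (norm z ^ (2 * ?n)) * f z) \<partial>lborel)"
      using AE_lborel_singleton[of 0]
    proof eventually_elim
      case (elim c)
      have "(\<integral>\<^sup>+z. k c * (?B z * ennreal (norm z ^ (2 * ?n)) * f (c *s z)) \<partial>lborel)
          = k c * (\<integral>\<^sup>+z. ?B z * ennreal (norm z ^ (2 * ?n)) * f (c *s z) \<partial>lborel)"
        by (rule nn_integral_cmult) measurable
      also have "\<dots> = (\<integral>\<^sup>+z. k c * (ennreal (1 / norm c ^ (4 * ?n)) * ennreal (norm z ^ (2 * ?n)) * f z * indicator {z. norm z < norm c} z) \<partial>lborel)"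
        unfolding 2[OF elim] by (rule nn_integral_cmult[symmetric]) measurable
      finally show ?case
        by (auto intro!: nn_integral_cong simp: indicator_def mult_ac)
    qed
  qed
  also have "\<dots> = (\<integral>\<^sup>+z. \<integral>\<^sup>+c. k c * ennreal (1 / norm c ^ (4 * ?n)) * indicator {c. norm z < norm c} c * (ennreal (norm z ^ (2 * ?n)) * f z) \<partial>lborel \<partial>lborel)"
    by (rule lborel_pair.Fubini') simp
  also have "\<dots> = (\<integral>\<^sup>+z. (\<integral>\<^sup>+c. k c * ennreal (1 / norm c ^ (4 * ?n)) * indicator {c. norm z < norm c} c \<partial>lborel) * (ennreal (norm z ^ (2 * ?n)) * f z) \<partial>lborel)"
    by (intro nn_integral_cong nn_integral_multc) measurable
  also have "\<dots> = (\<integral>\<^sup>+z. K' * f z \<partial>lborel)"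
  proof (rule nn_integral_cong_AE)
    show "AE z in lborel. (\<integral>\<^sup>+c. k c * ennreal (1 / norm c ^ (4 * ?n)) * indicator {c. norm z < norm c} c \<partial>lborel) * (ennreal (norm z ^ (2 * ?n)) * f z)
        = K' * f z"
      using AE_lborel_singleton[of 0]
    proof eventually_elim
      case (elim z)
      have "ennreal (1 / norm z ^ (2 * ?n)) * ennreal (norm z ^ (2 * ?n)) = 1"
        using elim by (simp flip: ennreal_mult)
      then show ?case
        unfolding 3[OF elim] by (metis (no_types, lifting) mult.assoc mult.commute mult.right_neutral)
    qed
  qed
  also have "\<dots> = K' * (\<integral>\<^sup>+z. f z \<partial>lborel)"
    by (rule nn_integral_cmult) simp
  finally show ?thesis by (simp add: k_def K'_def)
qed

text \<open>The constant is found by taking for \<open>f\<close> the indicator of the unit ball.\<close>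

theorem nn_integral_complex_lines:
  fixes f :: "complex ^ 'n \<Rightarrow> ennreal"
  assumes [measurable]: "f \<in> borel_measurable borel"
  shows "(\<integral>\<^sup>+z. indicator (ball 0 1) z *
       (\<integral>\<^sup>+c. ennreal (norm c ^ (2 * CARD('n) - 2)) * f (c *s sgn z) \<partial>lborel) \<partial>lborel)
     = weighted_area CARD('n) (ball 0 1) * (\<integral>\<^sup>+z. f z \<partial>lborel)"
proof -
  let ?n = "CARD('n)" and ?B = "ball 0 1 :: (complex ^ 'n) set"
  define K' where "K' = (\<integral>\<^sup>+c. ennreal (indicator {c. norm c > 1} c / norm c ^ (2 * ?n + 2)) \<partial>(lborel :: complex measure))"
  have B: "emeasure lborel ?B \<noteq> \<infinity>" "emeasure lborel ?B \<noteq> 0"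
    using emeasure_unit_ball by auto
  have [measurable, simp]: "?B \<in> sets borel" by simp
  have "K' * emeasure lborel ?B
      = (\<integral>\<^sup>+z. indicator ?B z * (\<integral>\<^sup>+c. ennreal (norm c ^ (2 * ?n - 2)) * indicator ?B (c *s sgn z) \<partial>lborel) \<partial>lborel)"
    unfolding K'_def by (subst nn_integral_complex_lines_aux[of "indicator ?B"]) simp_all
  also have "\<dots> = (\<integral>\<^sup>+z. weighted_area ?n (ball 0 1) * indicator ?B z \<partial>lborel)"
  proof (rule nn_integral_cong_AE)
    show "AE z in lborel. indicator ?B z * (\<integral>\<^sup>+c. ennreal (norm c ^ (2 * ?n - 2)) * indicator ?B (c *s sgn z) \<partial>lborel)
        = weighted_area ?n (ball 0 1) * indicator ?B z"
      using AE_lborel_singleton[of 0]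
    proof eventually_elim
      case (elim z)
      then have "indicator ?B (c *s sgn z) = (indicator (ball 0 1) c :: ennreal)" for c
        by (simp add: indicator_def norm_vector_smult norm_sgn)
      then show ?case by (simp add: weighted_area_def mult.commute)
    qed
  qed
  also have "\<dots> = weighted_area ?n (ball 0 1) * emeasure lborel ?B"
    by (simp add: nn_integral_cmult)
  finally have "K' = weighted_area ?n (ball 0 1)"
    using B by (simp add: mult.commute[of _ "emeasure lborel ?B"] ennreal_mult_cancel_left)
  with nn_integral_complex_lines_aux[of f] show ?thesis by (simp add: K'_def)
qed

subsection \<open>Weighted area in the plane\<close>

text \<open>Finiteness permits subtracting the integrals; the difference of the functions then has
  integral zero. It also makes \<open>g\<close> finite almost everywhere, without which a zero
  difference of extended reals would not give equality.\<close>

lemma AE_eq_if_nn_integral_eq: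
  assumes [measurable]: "f \<in> borel_measurable M" "g \<in> borel_measurable M"
    and le: "\<And>x. x \<in> space M \<Longrightarrow> f x \<le> g x"
    and eq: "(\<integral>\<^sup>+x. f x \<partial>M) = (\<integral>\<^sup>+x. g x \<partial>M)" and fin: "(\<integral>\<^sup>+x. g x \<partial>M) \<noteq> \<infinity>"
  shows "AE x in M. f x = g x"
proof -
  have "(\<integral>\<^sup>+x. g x - f x \<partial>M) = 0"
    using le eq fin by (subst nn_integral_diff) (auto intro!: AE_I2)
  then have "AE x in M. g x - f x = 0" by (simp add: nn_integral_0_iff_AE)
  moreover have "AE x in M. g x \<noteq> \<infinity>" using fin by (intro nn_integral_PInf_AE) auto
  moreover have "AE x in M. f x \<le> g x" using le by (intro AE_I2)
  ultimately show ?thesis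
    by eventually_elim (metis diff_eq_0_ennreal antisym ennreal_minus_eq_0)
qed

lemma emeasure_complex_ball:
  "r \<ge> 0 \<Longrightarrow> emeasure lborel (ball (0::complex) r) = ennreal (pi * r\<^sup>2)"
  by (simp add: emeasure_ball DIM_complex unit_ball_vol_2)

lemma weighted_area_add:
  assumes [measurable]: "E \<in> sets borel" "F \<in> sets borel"
  shows "weighted_area n E = weighted_area n (E \<inter> F) + weighted_area n (E - F)"
  unfolding weighted_area_def
  by (subst nn_integral_add[symmetric]) (auto intro!: nn_integral_cong simp: indicator_def)

text \<open>The area scales by r^2 and the weight by r^(2n-2). So the weighted area of a centred
  disc is proportional to the \<open>n\<close>-th power of its area, which is where the exponent of
  the theorem comes from.\<close>

lemma weighted_area_ball:
  assumes "n \<ge> 1" "r \<ge> 0"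
  shows "weighted_area n (ball 0 r) = weighted_area n (ball 0 1) * ennreal (r\<^sup>2) ^ n"
proof (cases "r = 0")
  case True
  then show ?thesis using assms by (simp add: weighted_area_def power_0_left)
next
  case False
  with assms have r: "r > 0" by simp
  have "weighted_area n (ball 0 r)
      = ennreal (r\<^sup>2) * (\<integral>\<^sup>+c. ennreal (norm (of_real r * c) ^ (2 * n - 2)) * indicator (ball 0 r) (of_real r * c :: complex) \<partial>lborel)"
    using nn_integral_lborel_similarity[of "\<lambda>c. of_real r * c" r "\<lambda>c. ennreal (norm c ^ (2 * n - 2)) * indicator (ball 0 r) (c::complex)"] r
    by (simp add: bounded_linear_mult_right bounded_linear.linear norm_mult DIM_complex weighted_area_def)
  also have "(\<lambda>c. ennreal (norm (of_real r * c) ^ (2 * n - 2)) * indicator (ball 0 r) (of_real r * c))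
      = (\<lambda>c::complex. ennreal (r ^ (2 * n - 2)) * (ennreal (norm c ^ (2 * n - 2)) * indicator (ball 0 1) c))"
    using r by (auto simp: fun_eq_iff indicator_def norm_mult power_mult_distrib ennreal_mult)
  also have "ennreal (r\<^sup>2) * (\<integral>\<^sup>+c. ennreal (r ^ (2 * n - 2)) * (ennreal (norm (c::complex) ^ (2 * n - 2)) * indicator (ball 0 1) c) \<partial>lborel)
      = ennreal (r\<^sup>2) * ennreal (r ^ (2 * n - 2)) * weighted_area n (ball 0 1)"
    by (simp add: nn_integral_cmult weighted_area_def mult.assoc)
  also have "ennreal (r\<^sup>2) * ennreal (r ^ (2 * n - 2)) = ennreal (r\<^sup>2) ^ n"
    using r power2_mult_power[OF assms(1), of r] by (simp add: ennreal_power power_mult flip: ennreal_mult)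
  finally show ?thesis by (simp add: mult.commute)
qed

lemma weighted_area_unit_ball: "weighted_area n (ball 0 1) \<noteq> 0" "weighted_area n (ball 0 1) \<noteq> \<infinity>"
proof
  assume "weighted_area n (ball 0 1) = 0"
  then have "AE c in lborel. ennreal (norm c ^ (2 * n - 2)) * indicator (ball 0 1) (c::complex) = 0"
    unfolding weighted_area_def by (subst (asm) nn_integral_0_iff_AE) auto
  with AE_lborel_singleton[of "0::complex"] have "AE c in lborel. (c::complex) \<notin> ball 0 1"
    by eventually_elim (auto simp: indicator_def)
  then have "emeasure lborel (ball (0::complex) 1) = 0"
    by (subst (asm) AE_iff_measurable[where N="ball 0 1"]) auto
  then show False using emeasure_unit_ball by blast
next
  have "weighted_area n (ball 0 1) \<le> (\<integral>\<^sup>+c. indicator (ball 0 1) (c::complex) \<partial>lborel)"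
    unfolding weighted_area_def
    by (intro nn_integral_mono) (auto simp: indicator_def intro!: power_le_one)
  also have "\<dots> = emeasure lborel (ball (0::complex) 1)" by simp
  also have "\<dots> < \<infinity>" by (rule emeasure_lborel_ball_finite)
  finally show "weighted_area n (ball 0 1) \<noteq> \<infinity>" by simp
qed

text \<open>Outside the unit disc the weight is at least 1, and inside it the area is bounded
  anyway. This provides the radius of a disc of equal area.\<close>

lemma area_finite_if_weighted_area_finite:
  assumes [measurable]: "E \<in> sets borel" and W: "weighted_area n E \<noteq> \<infinity>"
  shows "emeasure lborel E \<noteq> \<infinity>"
proof -
  let ?B = "ball (0::complex) 1"
  have "emeasure lborel (E - ?B) = (\<integral>\<^sup>+c. indicator (E - ?B) c \<partial>lborel)" by simp
  also have "\<dots> \<le> weighted_area n E"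
    unfolding weighted_area_def
    by (intro nn_integral_mono) (auto simp: indicator_def intro!: one_le_power)
  finally have "emeasure lborel (E - ?B) \<noteq> \<infinity>" using W by (auto simp: top_unique)
  moreover have "emeasure lborel (E \<inter> ?B) \<le> emeasure lborel ?B" by (intro emeasure_mono) auto
  then have "emeasure lborel (E \<inter> ?B) \<noteq> \<infinity>"
    using emeasure_unit_ball(2)[where 'a=complex] by (auto simp: top_unique)
  moreover have "emeasure lborel E = emeasure lborel (E \<inter> ?B) + emeasure lborel (E - ?B)"
    by (subst plus_emeasure) (auto intro!: arg_cong2[where f=emeasure])
  ultimately show ?thesis by simp
qed

text \<open>The bathtub principle: moving mass inwards to the centred disc of the same area decreases the
  weighted area.\<close>

lemma weighted_area_bathtub_disc:
  assumes E [measurable]: "E \<in> sets borel" and n: "n \<ge> 1" and r: "r \<ge> 0"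
    and area: "emeasure lborel E = emeasure lborel (ball (0::complex) r)"
  shows "weighted_area n (ball 0 r) \<le> weighted_area n E"
    and "n \<ge> 2 \<Longrightarrow> weighted_area n E \<noteq> \<infinity> \<Longrightarrow> weighted_area n (ball 0 r) = weighted_area n E
      \<Longrightarrow> sym_diff E (ball 0 r) \<in> null_sets lborel"
proof -
  define B where "B = ball (0::complex) r"
  have [measurable]: "B \<in> sets borel" by (simp add: B_def)
  \<comment> \<open>\<open>p\<close> is the weight on the circle of radius \<open>r\<close>. It
    separates the two pieces to be compared: the weight is at most \<open>p\<close> on
    \<open>B - E\<close> and at least \<open>p\<close> on \<open>E - B\<close>, and these have the
    same area.\<close>
  define p where "p = ennreal (r ^ (2 * n - 2))"
  have fin: "emeasure lborel B \<noteq> \<infinity>" using emeasure_lborel_ball_finite[of "0::complex" r] by (simp add: B_def)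
  have "emeasure lborel (E \<inter> B) + emeasure lborel (E - B) = emeasure lborel E"
    by (subst plus_emeasure) (auto intro!: arg_cong2[where f=emeasure])
  moreover have "emeasure lborel (E \<inter> B) + emeasure lborel (B - E) = emeasure lborel B"
    by (subst plus_emeasure) (auto intro!: arg_cong2[where f=emeasure])
  moreover have "emeasure lborel (E \<inter> B) \<le> emeasure lborel B"
    by (rule emeasure_mono) auto
  then have "emeasure lborel (E \<inter> B) \<noteq> \<infinity>" using fin by (auto simp: top_unique)
  ultimately have diff: "emeasure lborel (E - B) = emeasure lborel (B - E)"
    using area by (metis B_def ennreal_add_left_cancel infinity_ennreal_def)
  have fin': "emeasure lborel (E - B) \<noteq> \<infinity>"
    unfolding diff using fin emeasure_mono[of "B - E" B lborel] by (auto simp: top_unique)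
  have 1: "weighted_area n (B - E) \<le> p * emeasure lborel (B - E)"
  proof -
    have "weighted_area n (B - E) \<le> (\<integral>\<^sup>+c. p * indicator (B - E) c \<partial>lborel)"
      unfolding weighted_area_def p_def B_def
      by (intro nn_integral_mono) (auto simp: indicator_def intro!: ennreal_leI power_mono)
    then show ?thesis by (simp add: nn_integral_cmult)
  qed
  have le: "p * indicator (E - B) c \<le> ennreal (norm c ^ (2 * n - 2)) * indicator (E - B) c" for c
    unfolding p_def B_def using r by (auto simp: indicator_def intro!: ennreal_leI power_mono)
  have p: "(\<integral>\<^sup>+c. p * indicator (E - B) c \<partial>lborel) = p * emeasure lborel (E - B)"
    by (simp add: nn_integral_cmult)
  have 2: "p * emeasure lborel (E - B) \<le> weighted_area n (E - B)"
    unfolding weighted_area_def p[symmetric] by (intro nn_integral_mono le)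
  have E_split: "weighted_area n E = weighted_area n (E \<inter> B) + weighted_area n (E - B)"
    by (rule weighted_area_add) measurable
  have B_split: "weighted_area n B = weighted_area n (E \<inter> B) + weighted_area n (B - E)"
    using weighted_area_add[of B E n] by (simp add: Int_commute)
  have 3: "weighted_area n (B - E) \<le> weighted_area n (E - B)"
    using 1 2 diff by auto
  then show "weighted_area n (ball 0 r) \<le> weighted_area n E"
    unfolding E_split B_split[unfolded B_def] by (simp add: B_def add_left_mono)
  assume n2: "n \<ge> 2" and W: "weighted_area n E \<noteq> \<infinity>"
    and eq: "weighted_area n (ball 0 r) = weighted_area n E"
  have "weighted_area n (E \<inter> B) \<noteq> \<infinity>" "weighted_area n (E - B) \<noteq> \<infinity>"
    using W unfolding E_split by auto
  moreover have "weighted_area n (E \<inter> B) + weighted_area n (B - E) = weighted_area n (E \<inter> B) + weighted_area n (E - B)"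
    using eq unfolding E_split B_split[unfolded B_def] by (simp add: B_def)
  ultimately have "weighted_area n (B - E) = weighted_area n (E - B)"
    by (metis ennreal_add_left_cancel infinity_ennreal_def)
  with 1 2 diff have eq': "p * emeasure lborel (E - B) = weighted_area n (E - B)" by auto
  have "AE c in lborel. p * indicator (E - B) c = ennreal (norm c ^ (2 * n - 2)) * indicator (E - B) c"
  proof (rule AE_eq_if_nn_integral_eq)
    show "(\<integral>\<^sup>+c. p * indicator (E - B) c \<partial>lborel) = (\<integral>\<^sup>+c. ennreal (norm c ^ (2 * n - 2)) * indicator (E - B) c \<partial>lborel)"
      unfolding p eq' weighted_area_def ..
    show "(\<integral>\<^sup>+c. ennreal (norm c ^ (2 * n - 2)) * indicator (E - B) c \<partial>lborel) \<noteq> \<infinity>"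
      using \<open>weighted_area n (E - B) \<noteq> \<infinity>\<close> by (simp add: weighted_area_def)
  qed (use le in auto)
  \<comment> \<open>For \<open>n\<close> at least 2 the exponent is positive, so the weight equals
    \<open>p\<close> only on the circle of radius \<open>r\<close>. This circle is null, hence so is
    \<open>E - B\<close>.\<close>
  moreover have "AE c in lborel. norm (c::complex) \<noteq> r"
  proof (rule AE_I')
    have "sphere (0::complex) r \<in> null_sets lebesgue"
      using negligible_sphere[of "0::complex" r] by (simp add: negligible_iff_null_sets)
    then show "sphere (0::complex) r \<in> null_sets lborel"
      by (subst (asm) null_sets_completion_iff) auto
  qed auto
  ultimately have "AE c in lborel. c \<notin> E - B"
  proof eventually_elim
    case (elim c)
    show ?case
    proof
      assume c: "c \<in> E - B"
      with elim have "norm c ^ (2 * n - 2) = r ^ (2 * n - 2)" using r by (simp add: p_def)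
      then have "norm c = r" using n2 r by (subst (asm) power_eq_iff_eq_base) auto
      with elim show False by simp
    qed
  qed
  then have "emeasure lborel (E - B) = 0"
    by (subst (asm) AE_iff_measurable[where N="E - B"]) auto
  then show "sym_diff E (ball 0 r) \<in> null_sets lborel"
    using diff unfolding B_def[symmetric] by (intro null_sets.Un null_setsI) auto
qed

text \<open>Eliminates the radius, which varies with the section and would have to be carried
  through integrals over all lines. If the weighted area is infinite the inequality is trivial;
  otherwise the area is some finite \<open>a\<close> and the disc of radius sqrt (a / pi) serves as
  comparison.\<close>

lemma weighted_area_bathtub:
  assumes E [measurable]: "E \<in> sets borel" and n: "n \<ge> 1"
  shows "weighted_area n (ball 0 1) * (ennreal (1 / pi) * emeasure lborel E) ^ n \<le> weighted_area n E"
    and "n \<ge> 2 \<Longrightarrow> weighted_area n E \<noteq> \<infinity>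
      \<Longrightarrow> weighted_area n (ball 0 1) * (ennreal (1 / pi) * emeasure lborel E) ^ n = weighted_area n E
      \<Longrightarrow> \<exists>r. sym_diff E (ball 0 r) \<in> null_sets lborel"
proof -
  have *: "\<exists>r\<ge>0. emeasure lborel E = emeasure lborel (ball (0::complex) r) \<and>
      weighted_area n (ball 0 1) * (ennreal (1 / pi) * emeasure lborel E) ^ n = weighted_area n (ball 0 r)"
    if W: "weighted_area n E \<noteq> \<infinity>"
  proof -
    obtain a where a: "a \<ge> 0" "emeasure lborel E = ennreal a"
      using area_finite_if_weighted_area_finite[OF E W] by (cases "emeasure lborel E") auto
    define r where "r = sqrt (a / pi)"
    have r: "r \<ge> 0" "r\<^sup>2 = a / pi" using a by (auto simp: r_def)
    have "emeasure lborel E = emeasure lborel (ball (0::complex) r)"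
      using r a by (simp add: emeasure_complex_ball)
    moreover have "ennreal (1 / pi) * ennreal a = ennreal (r\<^sup>2)"
      using a by (simp add: r(2) flip: ennreal_mult)
    then have "weighted_area n (ball 0 1) * (ennreal (1 / pi) * emeasure lborel E) ^ n = weighted_area n (ball 0 r)"
      by (simp only: weighted_area_ball[OF n r(1)] a(2))
    ultimately show ?thesis using r(1) by blast
  qed
  show "weighted_area n (ball 0 1) * (ennreal (1 / pi) * emeasure lborel E) ^ n \<le> weighted_area n E"
  proof (cases "weighted_area n E = \<infinity>")
    case False
    from *[OF this] obtain r where "r \<ge> 0" "emeasure lborel E = emeasure lborel (ball (0::complex) r)"
      "weighted_area n (ball 0 1) * (ennreal (1 / pi) * emeasure lborel E) ^ n = weighted_area n (ball 0 r)"
      by blast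
    then show ?thesis using weighted_area_bathtub_disc(1)[OF E n] by metis
  qed simp
  assume n2: "n \<ge> 2" and W: "weighted_area n E \<noteq> \<infinity>"
    and eq: "weighted_area n (ball 0 1) * (ennreal (1 / pi) * emeasure lborel E) ^ n = weighted_area n E"
  from *[OF W] obtain r where r: "r \<ge> 0" "emeasure lborel E = emeasure lborel (ball (0::complex) r)"
      "weighted_area n (ball 0 1) * (ennreal (1 / pi) * emeasure lborel E) ^ n = weighted_area n (ball 0 r)"
      by blast
  show "\<exists>r. sym_diff E (ball 0 r) \<in> null_sets lborel"
    using weighted_area_bathtub_disc(2)[OF E n r(1,2) n2 W] eq r(3) by auto
qed

text \<open>The whole plane counts as a disc of infinite radius, since it occurs as a section of an
  unbounded domain; both sides are then infinite.\<close>

lemma weighted_area_disc: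
  assumes "n \<ge> 1" "E = UNIV \<or> (\<exists>r. E = ball 0 r)"
  shows "weighted_area n (ball 0 1) * (ennreal (1 / pi) * emeasure lborel E) ^ n = weighted_area n E"
proof (cases "E = UNIV")
  case True
  have "weighted_area n (ball 0 1) * (ennreal (1 / pi) * emeasure lborel E) ^ n = \<infinity>"
    using weighted_area_unit_ball[of n] assms(1) True by (simp add: ennreal_mult_top ennreal_mult_eq_top_iff)
  moreover have "E \<in> sets borel" using True by simp
  ultimately show ?thesis using weighted_area_bathtub(1)[of E n] assms(1) by (simp add: top_unique)
next
  case False
  then obtain s where "E = ball 0 s" using assms(2) by auto
  \<comment> \<open>A ball of negative radius is empty, but the area formula wants a radius that is
    not negative.\<close>
  then have "E = ball 0 (max s 0)" by (cases "s \<ge> 0") auto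
  then obtain r where r: "E = ball 0 (max r 0)" ..
  have "ennreal (1 / pi) * emeasure lborel E = ennreal ((max r 0)\<^sup>2)"
    unfolding r by (subst emeasure_complex_ball) (simp_all flip: ennreal_mult)
  then show ?thesis using weighted_area_ball[OF assms(1), of "max r 0"] r by simp
qed

subsection \<open>Uniformly distributed measures\<close>

text \<open>Christensen's uniqueness argument, in which only the metric survives from the group
  action. The ball masses \<open>g\<close> and \<open>h\<close> of the two measures are unrelated at
  the outset; \<open>S\<close> carries both measures and provides the centres.\<close>

locale uniformly_distributed_pair =
  fixes M N :: "'a::{metric_space, second_countable_topology} measure" and S :: "'a set"
    and g h :: "real \<Rightarrow> ennreal"
  assumes prob: "prob_space M" "prob_space N"
    and sets_eq: "sets M = sets borel" "sets N = sets borel"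
    and supp: "AE x in M. x \<in> S" "AE x in N. x \<in> S"
    and ball_M: "\<And>x r. x \<in> S \<Longrightarrow> r > 0 \<Longrightarrow> emeasure M (ball x r) = g r"
    and ball_N: "\<And>x r. x \<in> S \<Longrightarrow> r > 0 \<Longrightarrow> emeasure N (ball x r) = h r"
begin

lemma swap: "uniformly_distributed_pair N M S h g"
  using uniformly_distributed_pair_axioms by (simp add: uniformly_distributed_pair_def)

text \<open>Everything is read off from the product measure of the pairs at distance less than
  \<open>r\<close>. Integrating first over one variable gives a ball mass, constant on
  \<open>S\<close>; the symmetry of the distance allows the other order as well.\<close>

lemma nn_integral_ball_N:
  assumes r: "r > 0" and [measurable]: "f \<in> borel_measurable borel"
  shows "(\<integral>\<^sup>+x. \<integral>\<^sup>+y. f x * indicator {p. dist (fst p) (snd p) < r} (x, y) \<partial>N \<partial>M) = h r * (\<integral>\<^sup>+x. f x \<partial>M)"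
proof -
  note sets_eq[measurable_cong]
  have "(\<integral>\<^sup>+x. \<integral>\<^sup>+y. f x * indicator {p. dist (fst p) (snd p) < r} (x, y) \<partial>N \<partial>M) = (\<integral>\<^sup>+x. h r * f x \<partial>M)"
  proof (rule nn_integral_cong_AE)
    show "AE x in M. (\<integral>\<^sup>+y. f x * indicator {p. dist (fst p) (snd p) < r} (x, y) \<partial>N) = h r * f x"
      using supp(1)
    proof eventually_elim
      case (elim x)
      have "(\<integral>\<^sup>+y. f x * indicator {p. dist (fst p) (snd p) < r} (x, y) \<partial>N) = (\<integral>\<^sup>+y. f x * indicator (ball x r) y \<partial>N)"
        by (intro nn_integral_cong) (auto simp: indicator_def)
      also have "\<dots> = f x * emeasure N (ball x r)"
        by (rule nn_integral_cmult_indicator) (simp add: sets_eq)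
      finally show ?case using ball_N[OF elim r] by (simp add: mult.commute)
    qed
  qed
  also have "\<dots> = h r * (\<integral>\<^sup>+x. f x \<partial>M)" by (rule nn_integral_cmult) simp
  finally show ?thesis .
qed

lemma nn_integral_ball_swap:
  assumes [measurable]: "f \<in> borel_measurable borel"
  shows "(\<integral>\<^sup>+x. \<integral>\<^sup>+y. f y * indicator {p. dist (fst p) (snd p) < r} (x, y) \<partial>N \<partial>M)
    = (\<integral>\<^sup>+y. \<integral>\<^sup>+x. f y * indicator {p. dist (fst p) (snd p) < r} (y, x) \<partial>M \<partial>N)"
proof -
  note sets_eq[measurable_cong]
  interpret M: prob_space M by (rule prob(1))
  interpret N: prob_space N by (rule prob(2))
  interpret P: pair_sigma_finite M N ..
  have [measurable]: "{p. dist (fst p) (snd p) < r} \<in> sets (borel \<Otimes>\<^sub>M borel :: ('a \<times> 'a) measure)"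
    unfolding borel_prod by (intro borel_open open_Collect_less continuous_intros)
  have "(\<integral>\<^sup>+x. \<integral>\<^sup>+y. f y * indicator {p. dist (fst p) (snd p) < r} (x, y) \<partial>N \<partial>M)
      = (\<integral>\<^sup>+y. \<integral>\<^sup>+x. f y * indicator {p. dist (fst p) (snd p) < r} (x, y) \<partial>M \<partial>N)"
  proof (rule P.Fubini'[symmetric])
    have "(\<lambda>p. f (snd p) * indicator {p. dist (fst p) (snd p) < r} p) \<in> borel_measurable (borel \<Otimes>\<^sub>M borel)"
      by measurable
    also have "borel_measurable (borel \<Otimes>\<^sub>M borel) = borel_measurable (M \<Otimes>\<^sub>M N)"
      by (intro measurable_cong_sets sets_pair_measure_cong) (simp_all add: sets_eq)
    finally show "(\<lambda>(x, y). f y * indicator {p. dist (fst p) (snd p) < r} (x, y)) \<in> borel_measurable (M \<Otimes>\<^sub>M N)"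
      by (simp add: case_prod_beta)
  qed
  also have "\<dots> = (\<integral>\<^sup>+y. \<integral>\<^sup>+x. f y * indicator {p. dist (fst p) (snd p) < r} (y, x) \<partial>M \<partial>N)"
  proof (intro nn_integral_cong)
    fix x y :: 'a
    show "f x * indicator {p. dist (fst p) (snd p) < r} (y, x) = f x * indicator {p. dist (fst p) (snd p) < r} (x, y)"
      using dist_commute[of x y] by (auto simp: indicator_def)
  qed
  finally show ?thesis .
qed

text \<open>Both are the product measure of all pairs at distance less than \<open>r\<close>,
  computed in the two orders.\<close>

lemma g_eq_h:
  assumes "r > 0"
  shows "g r = h r"
proof -
  interpret M: prob_space M by (rule prob(1))
  interpret N: prob_space N by (rule prob(2))
  interpret swap: uniformly_distributed_pair N M S h g by (rule swap)
  show ?thesis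
    using nn_integral_ball_N[OF assms, of "\<lambda>_. 1"] swap.nn_integral_ball_N[OF assms, of "\<lambda>_. 1"]
      nn_integral_ball_swap[of "\<lambda>_. 1" r] by (simp add: M.emeasure_space_1 N.emeasure_space_1)
qed

text \<open>Otherwise, by the Lindelof property, countably many null balls would cover
  \<open>S\<close>, which has full measure.\<close>

lemma g_pos:
  assumes r: "r > 0"
  shows "g r \<noteq> 0"
proof
  assume 0: "g r = 0"
  interpret M: prob_space M by (rule prob(1))
  obtain F where F: "F \<subseteq> (\<lambda>x. ball x r) ` S" "countable F" "\<Union>F = \<Union>((\<lambda>x. ball x r) ` S)"
    using Lindelof[of "(\<lambda>x. ball x r) ` S"] by auto
  have "\<Union>F \<in> null_sets M"
  proof (rule null_sets_UN'[of F "\<lambda>x. x" M, simplified])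
    show "countable F" by fact
    fix X assume "X \<in> F"
    then obtain x where "x \<in> S" "X = ball x r" using F by auto
    then show "X \<in> null_sets M" using ball_M[of x r] r 0 by (auto simp: sets_eq)
  qed
  then have "AE x in M. x \<notin> \<Union>F" by (rule AE_not_in)
  with supp(1) have "AE x in M. False"
    by eventually_elim (use r F(3) in \<open>auto\<close>)
  then show False by simp
qed

text \<open>Shrink \<open>V\<close> to the set \<open>W k\<close> of points whose ball of radius
  \<open>r\<close> lies in \<open>V\<close>: a point within \<open>r\<close> of \<open>W k\<close>
  is then in \<open>V\<close>. Comparing the measures of pairs gives
  \<open>h r * emeasure M (W k) \<le> g r * emeasure N V\<close>; the common factor is positive and
  finite and cancels, and the sets \<open>W k\<close> exhaust \<open>V\<close>.\<close>

lemma emeasure_open_le: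
  assumes V: "open V"
  shows "emeasure M V \<le> emeasure N V"
proof -
  note sets_eq[measurable_cong]
  interpret M: prob_space M by (rule prob(1))
  interpret N: prob_space N by (rule prob(2))
  interpret swap: uniformly_distributed_pair N M S h g by (rule swap)
  have [measurable]: "{p. dist (fst p) (snd p) < r} \<in> sets (borel \<Otimes>\<^sub>M borel :: ('a \<times> 'a) measure)" for r
    unfolding borel_prod by (intro borel_open open_Collect_less continuous_intros)
  define W where "W = (\<lambda>k. {x. ball x (inverse (real (Suc k))) \<subseteq> V})"
  have W_closed: "closed (W k)" for k
  proof -
    have "- W k = (\<Union>y\<in>- V. ball y (inverse (real (Suc k))))"
      by (auto simp: W_def subset_eq dist_commute)
    then have "open (- W k)" by auto
    then show ?thesis by (simp add: closed_def)
  qed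
  then have [measurable]: "W k \<in> sets borel" for k by simp
  have [measurable]: "V \<in> sets borel" using V by simp
  have le: "emeasure M (W k) \<le> emeasure N V" for k
  proof -
    define r where "r = inverse (real (Suc k))"
    have r: "r > 0" by (simp add: r_def)
    have "h r * emeasure M (W k) = (\<integral>\<^sup>+x. \<integral>\<^sup>+y. indicator (W k) x * indicator {p. dist (fst p) (snd p) < r} (x, y) \<partial>N \<partial>M)"
      by (subst nn_integral_ball_N[OF r]) (simp_all add: sets_eq)
    also have "\<dots> \<le> (\<integral>\<^sup>+x. \<integral>\<^sup>+y. indicator V y * indicator {p. dist (fst p) (snd p) < r} (x, y) \<partial>N \<partial>M)"
      by (intro nn_integral_mono) (auto simp: W_def r_def indicator_def subset_eq)
    also have "\<dots> = (\<integral>\<^sup>+y. \<integral>\<^sup>+x. indicator V y * indicator {p. dist (fst p) (snd p) < r} (y, x) \<partial>M \<partial>N)"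
      by (rule nn_integral_ball_swap) simp
    also have "\<dots> = g r * emeasure N V"
      by (subst swap.nn_integral_ball_N[OF r]) (simp_all add: sets_eq)
    finally have *: "h r * emeasure M (W k) \<le> h r * emeasure N V" by (simp add: g_eq_h[OF r])
    have "h r \<noteq> 0" using g_pos[OF r] g_eq_h[OF r] by simp
    moreover have "S \<noteq> {}" using supp(1) by auto
    then obtain x where "x \<in> S" by auto
    then have "h r \<noteq> \<infinity>" using ball_N[of x r] r N.emeasure_finite[of "ball x r"] by auto
    ultimately show ?thesis using * by (simp add: ennreal_mult_le_mult_iff)
  qed
  have "V = (\<Union>k. W k)"
  proof safe
    fix x assume "x \<in> V"
    then obtain e where e: "e > 0" "ball x e \<subseteq> V" using V by (auto simp: open_contains_ball)
    then obtain k where "inverse (real (Suc k)) < e" using reals_Archimedean by blast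
    then have "ball x (inverse (real (Suc k))) \<subseteq> V" using e by (meson less_imp_le subset_ball subset_trans)
    then show "x \<in> (\<Union>k. W k)" by (auto simp: W_def)
  next
    fix x k assume "x \<in> W k"
    then show "x \<in> V" by (auto simp: W_def subset_eq)
  qed
  moreover have "incseq W"
  proof (rule incseq_SucI)
    fix k
    have "inverse (real (Suc (Suc k))) \<le> inverse (real (Suc k))" by (simp add: field_simps)
    then have "ball x (inverse (real (Suc (Suc k)))) \<subseteq> ball x (inverse (real (Suc k)))" for x :: 'a
      by (rule subset_ball)
    then show "W k \<subseteq> W (Suc k)" unfolding W_def by (metis (mono_tags) Collect_mono order_trans)
  qed
  ultimately have "emeasure M V = (SUP k. emeasure M (W k))"
    by (subst SUP_emeasure_incseq) (auto simp: sets_eq)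
  then show ?thesis using le by (auto intro: SUP_least)
qed

theorem eq: "M = N"
proof (rule measure_eqI_generator_eq[where E="{V. open V}" and A="\<lambda>_. UNIV" and \<Omega>=UNIV])
  interpret M: prob_space M by (rule prob(1))
  interpret swap: uniformly_distributed_pair N M S h g by (rule swap)
  fix X :: "'a set"
  assume "X \<in> {V. open V}"
  then have X: "open X" by simp
  show "emeasure M X = emeasure N X"
    using emeasure_open_le[OF X] swap.emeasure_open_le[OF X] by (rule antisym)
next
  interpret M: prob_space M by (rule prob(1))
  show "emeasure M UNIV \<noteq> \<infinity>" by simp
  have "sets (borel :: 'a measure) = sigma_sets UNIV {V. open V}"
    unfolding borel_def by (rule sets_measure_of) simp
  then show "sets M = sigma_sets UNIV {V. open V}" "sets N = sigma_sets UNIV {V. open V}"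
    unfolding sets_eq by simp_all
qed (auto simp: Int_stable_def)

end

subsection \<open>Lines and unitary matrices\<close>

definition hprod :: "complex ^ 'n \<Rightarrow> complex ^ 'n \<Rightarrow> complex" where
  "hprod u v = (\<Sum>i\<in>UNIV. u $ i * cnj (v $ i))"

definition line :: "complex ^ 'n \<Rightarrow> (complex ^ 'n) set" where
  "line z = range (\<lambda>c. c *s z)"

text \<open>For a unit vector this is the matrix of the orthogonal projection onto its complex line,
  so it forgets exactly the phase of \<open>u\<close>.\<close>

definition outer :: "complex ^ 'n \<Rightarrow> complex ^ 'n ^ 'n" where
  "outer u = (\<chi> i j. u $ i * cnj (u $ j))"

definition adjoint_mat :: "complex ^ 'n ^ 'n \<Rightarrow> complex ^ 'n ^ 'n" where
  "adjoint_mat U = (\<chi> i j. cnj (U $ j $ i))"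

lemma hprod_smult_left: "hprod (c *s u) v = c * hprod u v"
  and hprod_smult_right: "hprod u (c *s v) = cnj c * hprod u v"
  and hprod_diff_left: "hprod (u - w) v = hprod u v - hprod w v"
  and hprod_diff_right: "hprod u (v - w) = hprod u v - hprod u w"
  and cnj_hprod: "cnj (hprod u v) = hprod v u"
  by (simp_all add: hprod_def sum_distrib_left sum_subtractf algebra_simps)

lemma hprod_self: "hprod u u = complex_of_real ((norm u)\<^sup>2)"
  by (simp add: hprod_def norm_vec_def L2_set_def sum_nonneg complex_norm_square del: of_real_power)

lemma hprod_matrix_mult: "hprod (A *v u) v = hprod u (adjoint_mat A *v v)"
proof -
  have "hprod (A *v u) v = (\<Sum>i\<in>UNIV. \<Sum>j\<in>UNIV. A $ i $ j * u $ j * cnj (v $ i))"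
    by (simp add: hprod_def matrix_vector_mult_def sum_distrib_right)
  also have "\<dots> = (\<Sum>j\<in>UNIV. \<Sum>i\<in>UNIV. A $ i $ j * u $ j * cnj (v $ i))"
    by (rule sum.swap)
  also have "\<dots> = hprod u (adjoint_mat A *v v)"
    by (simp add: hprod_def matrix_vector_mult_def adjoint_mat_def sum_distrib_left mult_ac)
  finally show ?thesis .
qed

lemma adjoint_adjoint [simp]: "adjoint_mat (adjoint_mat U) = U"
  by (simp add: adjoint_mat_def vec_eq_iff)

lemma unitary_iff: "unitary U \<longleftrightarrow> adjoint_mat U ** U = mat 1"
  by (simp add: unitary_def adjoint_mat_def)

lemma unitary_adjoint: "unitary U \<Longrightarrow> unitary (adjoint_mat U)"
  unfolding unitary_iff adjoint_adjoint by (simp add: matrix_left_right_inverse)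

lemma unitary_adjoint_cancel:
  assumes "unitary U"
  shows "adjoint_mat U *v (U *v z) = z" "U *v (adjoint_mat U *v z) = z"
  using assms unitary_adjoint[OF assms] unfolding unitary_iff adjoint_adjoint
  by (simp_all add: matrix_vector_mul_assoc)

lemma hprod_unitary: "unitary U \<Longrightarrow> hprod (U *v u) (U *v v) = hprod u v"
  by (simp add: hprod_matrix_mult unitary_adjoint_cancel)

lemma norm_unitary: "unitary U \<Longrightarrow> norm (U *v u) = norm u"
  using hprod_unitary[of U u u] unfolding hprod_self of_real_eq_iff
  by (simp add: power2_eq_iff_nonneg)

lemma matrix_vector_mult_smult: "A *v (c *s (z :: complex ^ 'n)) = c *s (A *v z)"
  by (simp add: vec_eq_iff matrix_vector_mult_def sum_distrib_left mult_ac)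

lemma line_in_complex_lines: "z \<noteq> 0 \<Longrightarrow> line z \<in> complex_lines"
proof -
  assume "z \<noteq> 0"
  then have "vec.dim (vec.span {z}) = 1" by (simp add: vec.dim_eq_card_independent[of "{z}"])
  moreover have "line z = vec.span {z}" by (simp add: line_def vec.span_singleton)
  ultimately show ?thesis by (simp add: complex_lines_def)
qed

lemma line_smult: "c \<noteq> 0 \<Longrightarrow> line (c *s z) = line z"
proof -
  assume c: "c \<noteq> 0"
  have "range (\<lambda>d. (d * c) *s z) = range ((\<lambda>d. d *s z) \<circ> (\<lambda>d. d * c))" by (simp add: comp_def)
  also have "\<dots> = (\<lambda>d. d *s z) ` range (\<lambda>d. d * c)" by (simp only: image_comp)
  also have "range (\<lambda>d. d * c) = UNIV"
    using c by (intro surjI[of _ "\<lambda>d. d / c"]) simp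
  finally show ?thesis by (simp add: line_def vector_smult_assoc)
qed

lemma mem_lineI: "z \<in> line z"
  unfolding line_def by (rule range_eqI[of _ _ 1]) simp

lemma line_sgn: "line (sgn z) = line z" if "z \<noteq> 0"
proof -
  have "sgn z = complex_of_real (inverse (norm z)) *s z"
    unfolding vector_smult_of_real sgn_div_norm ..
  then show ?thesis using that line_smult[of "complex_of_real (inverse (norm z))" z] by simp
qed

lemma mem_line_eq: "w \<in> line z \<Longrightarrow> w \<noteq> 0 \<Longrightarrow> line w = line z"
proof -
  assume "w \<in> line z" "w \<noteq> 0"
  then obtain c where c: "w = c *s z" by (auto simp: line_def)
  with \<open>w \<noteq> 0\<close> have "c \<noteq> 0" by auto
  then show "line w = line z" unfolding c by (rule line_smult)
qed

lemma complex_lines_cases: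
  assumes "L \<in> complex_lines"
  obtains u where "norm u = 1" "L = line u"
proof -
  have L: "vec.subspace L" "vec.dim L = 1" using assms by (auto simp: complex_lines_def)
  obtain B where B: "B \<subseteq> L" "vec.independent B" "L \<subseteq> vec.span B" "card B = vec.dim L"
    using vec.basis_exists by blast
  then obtain z where z: "B = {z}" using L(2) by (metis card_1_singletonE)
  have "L = vec.span {z}"
    using B z vec.span_subspace[OF B(1,3) L(1)] by simp
  then have "L = line z" by (simp add: line_def vec.span_singleton)
  moreover have "z \<noteq> 0" using B(2) z vec.dependent_zero by auto
  ultimately show ?thesis using that[of "sgn z"] by (simp add: line_sgn norm_sgn)
qed

lemma complex_lines_mem_eq: "L \<in> complex_lines \<Longrightarrow> z \<in> L \<Longrightarrow> z \<noteq> 0 \<Longrightarrow> L = line z"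
  by (metis complex_lines_cases mem_line_eq)

text \<open>Distinct lines meet only in the origin, so a nonzero vector lies on just one line. This
  translates between a set of lines and the cone they fill.\<close>

lemma Union_lines_iff: "V \<subseteq> complex_lines \<Longrightarrow> z \<noteq> 0 \<Longrightarrow> z \<in> \<Union>V \<longleftrightarrow> line z \<in> V"
  using complex_lines_mem_eq mem_lineI by blast

lemma image_line: "(*v) U ` line z = line (U *v z)"
  by (simp add: line_def image_image matrix_vector_mult_smult)

lemma outer_smult: "norm c = 1 \<Longrightarrow> outer (c *s u) = outer u"
proof -
  assume "norm c = 1"
  then have "c * cnj c = 1" by (simp add: complex_norm_square[symmetric])
  then have "c * a * (cnj c * b) = a * b" for a b by (metis mult.assoc mult.left_commute mult_1)
  then show ?thesis by (simp add: outer_def vec_eq_iff)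
qed

lemma outer_mult: "outer u *v x = hprod x u *s u"
  by (simp add: outer_def vec_eq_iff matrix_vector_mult_def hprod_def sum_distrib_left mult_ac)

lemma continuous_on_outer [continuous_intros]:
  "continuous_on S f \<Longrightarrow> continuous_on S (\<lambda>x. outer (f x))"
  unfolding outer_def by (intro continuous_intros)

lemma line_eq_imp_outer_eq:
  assumes "norm u = 1" "norm v = 1" "line u = line v"
  shows "outer u = outer v"
proof -
  have "u \<in> line v" using mem_lineI[of u] assms by simp
  then obtain c where c: "u = c *s v" by (auto simp: line_def)
  then have "norm c = 1" using assms by (simp add: norm_vector_smult)
  then show ?thesis using c outer_smult by simp
qed

text \<open>The line is the range of its projection: \<open>u\<close> is fixed by its own
  projection, hence by that of \<open>v\<close>, whose values are multiples of
  \<open>v\<close>.\<close>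

lemma outer_eq_imp_line_eq:
  assumes "norm u = 1" "norm v = 1" "outer u = outer v"
  shows "line u = line v"
proof -
  have "u = outer u *v u" using assms(1) by (simp add: outer_mult hprod_self)
  also have "\<dots> = hprod u v *s v" by (simp add: assms(3) outer_mult)
  finally have "u \<in> line v" by (auto simp: line_def)
  moreover have "u \<noteq> 0" using assms(1) by auto
  ultimately show ?thesis by (rule mem_line_eq)
qed

text \<open>Shows that the distance of two projections depends only on Hermitian products, which
  unitary maps preserve. Hence they act by isometries in \<open>dist_outer_unitary\<close>.\<close>

lemma inner_outer: "inner (outer u) (outer v) = (norm (hprod u v))\<^sup>2"
proof -
  have "inner (outer u) (outer v) = Re (\<Sum>i\<in>UNIV. \<Sum>j\<in>UNIV. (u $ i * cnj (u $ j)) * cnj (v $ i * cnj (v $ j)))"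
    by (simp add: inner_vec_def outer_def inner_complex_def algebra_simps)
  also have "(\<Sum>i\<in>UNIV. \<Sum>j\<in>UNIV. (u $ i * cnj (u $ j)) * cnj (v $ i * cnj (v $ j)))
      = hprod u v * cnj (hprod u v)"
    by (simp add: hprod_def sum_product mult_ac)
  also have "\<dots> = complex_of_real ((norm (hprod u v))\<^sup>2)"
    by (simp only: complex_norm_square)
  finally show ?thesis by simp
qed

lemma dist_outer_unitary:
  assumes "unitary U"
  shows "dist (outer (U *v u)) (outer (U *v v)) = dist (outer u) (outer v)"
  by (simp add: dist_norm norm_eq_sqrt_inner inner_diff_left inner_diff_right inner_outer
      hprod_unitary[OF assms])

text \<open>After multiplying \<open>v\<close> by a phase \<open>hprod u v\<close> is real, and then the Householder reflection in
  \<open>u - v\<close> is unitary and sends \<open>u\<close> to \<open>v\<close>.\<close>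

lemma unitary_transitive:
  fixes u v :: "complex ^ 'n"
  assumes u: "norm u = 1" and v: "norm v = 1"
  obtains U where "unitary U" "line (U *v u) = line v"
proof -
  \<comment> \<open>The product is conjugate linear in its second argument, so \<open>v\<close> must
    be multiplied by the phase of \<open>hprod u v\<close> itself and not by its conjugate. If the
    product vanishes, any phase will do.\<close>
  define c where "c = (if hprod u v = 0 then 1 else sgn (hprod u v))"
  have c: "norm c = 1" by (simp add: c_def norm_sgn)
  define v' where "v' = c *s v"
  have v': "norm v' = 1" "line v' = line v"
    using c v by (auto simp: v'_def norm_vector_smult intro!: line_smult)
  define a where "a = norm (hprod u v)"
  have uv: "hprod u v' = of_real a"
  proof (cases "hprod u v = 0")
    case False
    have "hprod u v' = cnj (sgn (hprod u v)) * hprod u v"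
      using False by (simp add: v'_def hprod_smult_right c_def)
    also have "\<dots> = of_real (inverse a) * (hprod u v * cnj (hprod u v))"
      by (simp add: sgn_div_norm a_def scaleR_conv_of_real)
    also have "\<dots> = of_real a"
      unfolding complex_norm_square[symmetric] a_def using False by (simp add: power2_eq_square)
    finally show ?thesis .
  qed (simp add: v'_def hprod_smult_right a_def)
  have vu: "hprod v' u = of_real a" using cnj_hprod[of u v'] uv by simp
  show ?thesis
  proof (cases "u = v'")
    case True
    have "adjoint_mat (mat 1 :: complex ^ 'n ^ 'n) = mat 1"
      by (simp add: adjoint_mat_def vec_eq_iff mat_def)
    then show ?thesis using True v' that[of "mat 1"] by (simp add: unitary_iff)
  next
    case False
    define w where "w = u - v'"
    have ww: "hprod w w = of_real (2 - 2 * a)"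
      unfolding w_def hprod_diff_left hprod_diff_right using u v' uv vu by (simp add: hprod_self)
    have uw: "hprod u w = of_real (1 - a)"
      using u uv by (simp add: w_def hprod_diff_right hprod_self)
    have "w \<noteq> 0" using False by (simp add: w_def)
    then have a: "1 - a \<noteq> 0" using ww unfolding hprod_self of_real_eq_iff by auto
    \<comment> \<open>This is 2 / \<open>hprod w w\<close>, the coefficient of a reflection. As
      \<open>hprod u w\<close> is the real number 1 - a, it is also the coefficient for which
      \<open>u\<close> moves by exactly \<open>w\<close>.\<close>
    define k where "k = complex_of_real (1 / (1 - a))"
    define U where "U = mat 1 - (\<chi> i j. k * outer w $ i $ j)"
    have U: "U *v x = x - (k * hprod x w) *s w" for x
    proof -
      have "(\<chi> i j. k * outer w $ i $ j) *v x = k *s (outer w *v x)"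
        by (simp add: vec_eq_iff matrix_vector_mult_def sum_distrib_left mult_ac)
      then show ?thesis
        by (simp add: U_def matrix_vector_mult_diff_rdistrib outer_mult vector_smult_assoc)
    qed
    have "cnj k = k" by (simp add: k_def)
    then have "adjoint_mat U = U"
      by (simp add: adjoint_mat_def U_def vec_eq_iff outer_def mat_def mult_ac)
    moreover have "U *v (U *v x) = x" for x
    proof -
      have "k * hprod w w = 2" using a by (simp add: ww k_def flip: of_real_mult of_real_divide)
           (simp add: field_simps)
      then have "k * hprod (x - (k * hprod x w) *s w) w = - (k * hprod x w)"
        by (simp add: hprod_diff_left hprod_smult_left algebra_simps)
      then show ?thesis by (simp add: U)
    qed
    ultimately have "unitary U"
      by (simp add: unitary_iff matrix_eq flip: matrix_vector_mul_assoc)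
    moreover have "U *v u = v'"
    proof -
      have "k * hprod u w = 1" using a by (simp add: uw k_def flip: of_real_mult)
      then show ?thesis by (simp add: U w_def)
    qed
    ultimately show ?thesis using that[of U] v' by simp
  qed
qed

subsection \<open>The invariant measure on the Grassmannian\<close>

text \<open>Carries only the sigma algebra, so that measurability can be treated before an invariant
  measure is known to exist.\<close>

definition grassmann_sigma :: "(complex ^ 'n) set measure" where
  "grassmann_sigma = sigma complex_lines {V. grassmann_open V}"

lemma grassmann_open_subset: "{V. grassmann_open V} \<subseteq> Pow complex_lines"
  by (auto simp: grassmann_open_def)

lemma space_grassmann_sigma [simp]: "space grassmann_sigma = complex_lines"
  unfolding grassmann_sigma_def by (rule space_measure_of[OF grassmann_open_subset])

lemma sets_grassmann_sigma: "sets grassmann_sigma = sigma_sets complex_lines {V. grassmann_open V}"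
  unfolding grassmann_sigma_def by (rule sets_measure_of[OF grassmann_open_subset])

lemma grassmann_open_in_sets: "grassmann_open V \<Longrightarrow> V \<in> sets grassmann_sigma"
  unfolding sets_grassmann_sigma by (rule sigma_sets.Basic) simp

lemma Union_Collect_lines:
  "\<Union>{L \<in> complex_lines. Q L} - {0} = {z. z \<noteq> 0 \<and> Q (line z)}"
proof (intro set_eqI)
  fix z
  show "z \<in> \<Union>{L \<in> complex_lines. Q L} - {0} \<longleftrightarrow> z \<in> {z. z \<noteq> 0 \<and> Q (line z)}"
    using Union_lines_iff[of "{L \<in> complex_lines. Q L}" z] line_in_complex_lines[of z] by blast
qed

lemma grassmann_openI:
  assumes "open {z. z \<noteq> 0 \<and> Q (line z)}"
  shows "grassmann_open {L \<in> complex_lines. Q L}"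
  unfolding grassmann_open_def Union_Collect_lines using assms by auto

text \<open>The matrix of the orthogonal projection onto \<open>L\<close>: it turns measures on the Grassmannian into
  Borel measures on a metric space.\<close>

definition line_proj :: "(complex ^ 'n) set \<Rightarrow> complex ^ 'n ^ 'n" where
  "line_proj L = outer (SOME u. norm u = 1 \<and> L = line u)"

lemma line_proj_unit: "norm u = 1 \<Longrightarrow> line_proj (line u) = outer u"
proof -
  assume u: "norm u = 1"
  have "norm (SOME v. norm v = 1 \<and> line u = line v) = 1 \<and> line u = line (SOME v. norm v = 1 \<and> line u = line v)"
    by (rule someI[of "\<lambda>v. norm v = 1 \<and> line u = line v" u]) (simp add: u)
  then show ?thesis unfolding line_proj_def using u by (intro line_eq_imp_outer_eq) auto
qed

lemma line_proj_line: "z \<noteq> 0 \<Longrightarrow> line_proj (line z) = outer (sgn z)"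
  using line_proj_unit[of "sgn z"] by (simp add: norm_sgn line_sgn)

lemma line_proj_vimage_open:
  fixes X :: "(complex ^ 'n ^ 'n) set"
  assumes "open X"
  shows "grassmann_open {L \<in> complex_lines. line_proj L \<in> X}"
proof (rule grassmann_openI)
  have "open ((\<lambda>z. outer (sgn z)) -` X \<inter> (- {0 :: complex ^ 'n}))"
    using assms by (intro continuous_on_open_vimage[THEN iffD1, rule_format] continuous_intros)
      (auto simp: sgn_div_norm intro!: continuous_intros)
  also have "(\<lambda>z. outer (sgn z)) -` X \<inter> (- {0 :: complex ^ 'n}) = {z. z \<noteq> 0 \<and> line_proj (line z) \<in> X}"
    by (auto simp: line_proj_line)
  finally show "open {z :: complex ^ 'n. z \<noteq> 0 \<and> line_proj (line z) \<in> X}" .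
qed

lemma measurable_line_proj [measurable]: "line_proj \<in> borel_measurable grassmann_sigma"
proof (rule borel_measurableI)
  fix X :: "(complex ^ 'n ^ 'n) set"
  assume "open X"
  then have "{L \<in> complex_lines. line_proj L \<in> X} \<in> sets grassmann_sigma"
    by (intro grassmann_open_in_sets line_proj_vimage_open)
  then show "line_proj -` X \<inter> space grassmann_sigma \<in> sets grassmann_sigma"
    by (simp add: vimage_def Collect_conj_eq Int_commute)
qed

text \<open>Compactness makes \<open>line_proj\<close> an embedding: the unit vectors on lines
  outside \<open>V\<close> form a compact set \<open>K\<close>, and \<open>X\<close> is the
  complement of its compact image. Together with \<open>line_proj_vimage_open\<close>, measures on
  the Grassmannian can be compared through their images.\<close>

lemma grassmann_open_eq_vimage:
  assumes "grassmann_open (V :: (complex ^ 'n) set set)"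
  obtains X where "open X" "V = {L \<in> complex_lines. line_proj L \<in> X}"
proof -
  define K where "K = sphere (0 :: complex ^ 'n) 1 - (\<Union>V - {0})"
  have V: "V \<subseteq> complex_lines" "open (\<Union>V - {0})" using assms by (auto simp: grassmann_open_def)
  have "compact K" unfolding K_def using V(2) by (intro compact_diff compact_sphere)
  then have "compact (outer ` K)" by (intro compact_continuous_image continuous_intros)
  then have "open (- outer ` K)" by (simp add: compact_imp_closed open_Compl)
  moreover have "V = {L \<in> complex_lines. line_proj L \<in> - outer ` K}"
  proof (intro set_eqI)
    fix L
    show "L \<in> V \<longleftrightarrow> L \<in> {L \<in> complex_lines. line_proj L \<in> - outer ` K}"
    proof (cases "L \<in> complex_lines")
      case True
      then obtain u where u: "norm u = 1" "L = line u" by (rule complex_lines_cases)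
      then have u0: "u \<noteq> 0" by auto
      have "line_proj L \<in> outer ` K \<longleftrightarrow> L \<notin> V"
      proof
        assume "line_proj L \<in> outer ` K"
        then obtain v where v: "v \<in> K" "line_proj L = outer v" by auto
        then have v: "v \<in> K" "outer u = outer v" using line_proj_unit[OF u(1)] by (simp_all add: u(2))
        then have v1: "norm v = 1" "v \<noteq> 0" by (auto simp: K_def)
        then have "line u = line v" using u v by (intro outer_eq_imp_line_eq) auto
        moreover have "v \<notin> \<Union>V" using v(1) v1(2) by (simp add: K_def)
        ultimately show "L \<notin> V" using Union_lines_iff[OF V(1) v1(2)] u(2) by simp
      next
        assume "L \<notin> V"
        then have "u \<notin> \<Union>V" using u(2) Union_lines_iff[OF V(1) u0] by simp
        then have "u \<in> K" using u(1) by (simp add: K_def)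
        then show "line_proj L \<in> outer ` K" by (simp add: u line_proj_unit)
      qed
      then show ?thesis using True by auto
    qed (use V(1) in auto)
  qed
  ultimately show ?thesis by (rule that)
qed

lemma Int_stable_grassmann_open: "Int_stable {V. grassmann_open V}"
proof (rule Int_stableI)
  fix A B :: "(complex ^ 'n) set set"
  assume "A \<in> {V. grassmann_open V}" "B \<in> {V. grassmann_open V}"
  then have A: "grassmann_open A" and B: "grassmann_open B" by simp_all
  obtain X where X: "open X" "A = {L \<in> complex_lines. line_proj L \<in> X}"
    using A by (rule grassmann_open_eq_vimage)
  obtain Y where Y: "open Y" "B = {L \<in> complex_lines. line_proj L \<in> Y}"
    using B by (rule grassmann_open_eq_vimage)
  have "A \<inter> B = {L \<in> complex_lines. line_proj L \<in> X \<inter> Y}" unfolding X(2) Y(2) by auto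
  then show "A \<inter> B \<in> {V. grassmann_open V}"
    using line_proj_vimage_open[OF open_Int[OF X(1) Y(1)]] by simp
qed

text \<open>A unitary map taking the line of \<open>u\<close> to that of \<open>v\<close> acts
  isometrically on projections, so it takes the lines in one ball onto the lines in the
  other.\<close>

lemma emeasure_line_proj_ball:
  fixes u v :: "complex ^ 'n"
  assumes M: "unitary_invariant_prob M" and u: "norm u = 1" and v: "norm v = 1"
  shows "emeasure (distr M borel line_proj) (ball (outer u) r) = emeasure (distr M borel line_proj) (ball (outer v) r)"
proof -
  have M': "sets M = sets grassmann_sigma" "space M = complex_lines"
    using M by (auto simp: unitary_invariant_prob_def sets_grassmann_sigma)
  have [measurable]: "line_proj \<in> borel_measurable M"
    using measurable_line_proj M'(1) measurable_cong_sets by blast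
  define A where "A = (\<lambda>w :: complex ^ 'n. {L \<in> complex_lines. dist (outer w) (line_proj L) < r})"
  have E: "emeasure (distr M borel line_proj) (ball (outer w) r) = emeasure M (A w)" for w
    by (subst emeasure_distr) (auto simp: A_def M'(2) intro!: arg_cong2[where f=emeasure])
  have meas: "A w \<in> sets M" for w
  proof -
    have "A w = line_proj -` ball (outer w) r \<inter> space M" by (auto simp: A_def M'(2))
    then show ?thesis by simp
  qed
  obtain U where U: "unitary U" "line (U *v u) = line v" using unitary_transitive[OF u v] .
  have ouv: "outer (U *v u) = outer v"
    using U u v by (intro line_eq_imp_outer_eq) (simp_all add: norm_unitary)
  have iff: "line w \<in> A u \<longleftrightarrow> line (U *v w) \<in> A v" if w: "norm w = 1" for w
  proof -
    have "line w \<in> complex_lines" "line (U *v w) \<in> complex_lines"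
      using w norm_unitary[OF U(1), of w] by (auto intro!: line_in_complex_lines)
    then show ?thesis
      using dist_outer_unitary[OF U(1), of u w] w norm_unitary[OF U(1), of w]
      by (simp add: A_def line_proj_unit ouv)
  qed
  have "(\<lambda>L. (*v) U ` L) ` A u = A v"
  proof (intro equalityI subsetI)
    fix L assume "L \<in> (\<lambda>L. (*v) U ` L) ` A u"
    then obtain L' where L': "L' \<in> A u" "L = (*v) U ` L'" by auto
    then have "L' \<in> complex_lines" by (simp add: A_def)
    then obtain w where "norm w = 1" "L' = line w" by (rule complex_lines_cases)
    then show "L \<in> A v" using L' iff by (simp add: image_line)
  next
    fix L assume L: "L \<in> A v"
    then have "L \<in> complex_lines" by (simp add: A_def)
    then obtain w where w: "norm w = 1" "L = line w" by (rule complex_lines_cases)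
    define w' where "w' = adjoint_mat U *v w"
    have w': "norm w' = 1" "U *v w' = w"
      using w U(1) by (simp_all add: w'_def norm_unitary unitary_adjoint unitary_adjoint_cancel)
    have "line w' \<in> A u" using iff[OF w'(1)] w' L w by simp
    moreover have "L = (*v) U ` line w'" using w' w by (simp add: image_line)
    ultimately show "L \<in> (\<lambda>L. (*v) U ` L) ` A u" by auto
  qed
  then have "emeasure M (A v) = emeasure M (A u)"
    using M U(1) meas[of u] unfolding unitary_invariant_prob_def by metis
  then show ?thesis by (simp add: E)
qed

text \<open>The images under \<open>line_proj\<close> live on the compact set \<open>S\<close> of
  projections onto lines and form a uniformly distributed pair. Equality descends because the open
  sets of the Grassmannian are preimages and generate its sigma algebra.\<close>

theorem unitary_invariant_prob_unique:
  fixes M N :: "(complex ^ 'n) set measure"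
  assumes M: "unitary_invariant_prob M" and N: "unitary_invariant_prob N"
  shows "M = N"
proof -
  \<comment> \<open>An arbitrary unit vector: its projection is the reference centre at which the
    ball masses are measured.\<close>
  define e :: "complex ^ 'n" where "e = axis undefined 1"
  have e: "norm e = 1" by (simp add: e_def)
  define S where "S = outer ` sphere (0 :: complex ^ 'n) 1"
  have S: "line_proj L \<in> S" if L: "L \<in> complex_lines" for L
  proof -
    obtain u where "norm u = 1" "L = line u" by (rule complex_lines_cases[OF L])
    then show ?thesis by (simp add: line_proj_unit S_def)
  qed
  have [measurable]: "S \<in> sets borel"
    unfolding S_def by (intro borel_closed compact_imp_closed compact_continuous_image continuous_intros compact_sphere)
  have props: "prob_space (distr P borel line_proj)" "AE x in distr P borel line_proj. x \<in> S"
     "\<And>x r. x \<in> S \<Longrightarrow> emeasure (distr P borel line_proj) (ball x r) = emeasure (distr P borel line_proj) (ball (outer e) r)"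
    and meas: "line_proj \<in> borel_measurable P"
    and sets: "sets P = sigma_sets complex_lines {V. grassmann_open V}"
    and prob: "prob_space P" and space: "space P = complex_lines"
    if P: "unitary_invariant_prob P" for P :: "(complex ^ 'n) set measure"
  proof -
    show prob: "prob_space P" and space: "space P = complex_lines"
      and sets: "sets P = sigma_sets complex_lines {V. grassmann_open V}"
      using P by (auto simp: unitary_invariant_prob_def)
    show meas[measurable]: "line_proj \<in> borel_measurable P"
      using measurable_line_proj sets measurable_cong_sets sets_grassmann_sigma by blast
    show "prob_space (distr P borel line_proj)"
      using prob meas by (rule prob_space.prob_space_distr)
    show "AE x in distr P borel line_proj. x \<in> S"
      by (subst AE_distr_iff) (auto simp: space intro!: AE_I2 S)
    show "emeasure (distr P borel line_proj) (ball x r) = emeasure (distr P borel line_proj) (ball (outer e) r)"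
      if "x \<in> S" for x r
      using that emeasure_line_proj_ball[OF P _ e] by (auto simp: S_def)
  qed
  have "uniformly_distributed_pair (distr M borel line_proj) (distr N borel line_proj) S
      (\<lambda>r. emeasure (distr M borel line_proj) (ball (outer e) r))
      (\<lambda>r. emeasure (distr N borel line_proj) (ball (outer e) r))"
    using props(1,2)[OF M] props(1,2)[OF N] props(3)[OF M] props(3)[OF N]
    by (intro uniformly_distributed_pair.intro) simp_all
  then have eq: "distr M borel line_proj = distr N borel line_proj"
    by (rule uniformly_distributed_pair.eq)
  show ?thesis
  proof (rule measure_eqI_generator_eq[OF Int_stable_grassmann_open grassmann_open_subset])
    fix V assume "V \<in> {V :: (complex ^ 'n) set set. grassmann_open V}"
    then obtain X where X: "open X" "V = {L \<in> complex_lines. line_proj L \<in> X}"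
      using grassmann_open_eq_vimage by auto
    have "emeasure (distr P borel line_proj) X = emeasure P V"
      if "unitary_invariant_prob P" for P :: "(complex ^ 'n) set measure"
      using X meas[OF that] space[OF that]
      by (subst emeasure_distr) (auto intro!: arg_cong2[where f=emeasure])
    from this[OF M] this[OF N] eq show "emeasure M V = emeasure N V" by simp
  next
    have "grassmann_open (complex_lines :: (complex ^ 'n) set set)"
      using line_proj_vimage_open[of UNIV] by simp
    then show "range (\<lambda>_::nat. complex_lines) \<subseteq> {V :: (complex ^ 'n) set set. grassmann_open V}" by auto
    interpret M: prob_space M by (rule prob[OF M])
    show "emeasure M complex_lines \<noteq> \<infinity>" by simp
  qed (use sets M N in auto)
qed

text \<open>\<open>sgn 0\<close> is the zero vector, which spans no line; a fixed unit vector at the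
  origin makes the map to lines total and alters it only on a null set.\<close>

definition direction :: "complex ^ 'n \<Rightarrow> complex ^ 'n" where
  "direction z = (if z = 0 then axis undefined 1 else sgn z)"

lemma norm_direction [simp]: "norm (direction z) = 1"
  by (simp add: direction_def norm_sgn)

lemma line_direction: "z \<noteq> 0 \<Longrightarrow> line (direction z) = line z"
  by (simp add: direction_def line_sgn)

lemma line_direction_in_complex_lines: "line (direction z) \<in> complex_lines"
  by (rule line_in_complex_lines) (metis norm_direction norm_zero zero_neq_one)

lemma measurable_line_direction [measurable]:
  "(\<lambda>z. line (direction z)) \<in> measurable borel grassmann_sigma"
  unfolding grassmann_sigma_def
proof (rule measurable_measure_of[OF grassmann_open_subset])
  fix V :: "(complex ^ 'n) set set"
  assume "V \<in> {V. grassmann_open V}"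
  then have V: "V \<subseteq> complex_lines" "open (\<Union>V - {0})" by (auto simp: grassmann_open_def)
  have "(\<lambda>z. line (direction z)) -` V = (\<Union>V - {0}) \<union> (if line (direction 0) \<in> V then {0} else {})"
  proof (rule set_eqI)
    fix z
    show "z \<in> (\<lambda>z. line (direction z)) -` V \<longleftrightarrow> z \<in> (\<Union>V - {0}) \<union> (if line (direction 0) \<in> V then {0} else {})"
      using Union_lines_iff[OF V(1), of z] line_direction[of z] by (cases "z = 0") simp_all
  qed
  also have "\<dots> \<in> sets borel" using V(2) by (intro sets.Un) auto
  finally show "(\<lambda>z. line (direction z)) -` V \<inter> space borel \<in> sets borel" by simp
qed (use line_direction_in_complex_lines in auto)

lemma measurable_unitary_image:
  fixes U :: "complex ^ 'n ^ 'n"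
  assumes U: "unitary U"
  shows "(\<lambda>L. (*v) U ` L) \<in> measurable grassmann_sigma grassmann_sigma"
proof (subst (2) grassmann_sigma_def, rule measurable_measure_of[OF grassmann_open_subset])
  have Uz: "U *v z \<noteq> 0" if "z \<noteq> 0" for z
    using norm_unitary[OF U, of z] that by auto
  have lines: "(*v) U ` L \<in> complex_lines" if L: "L \<in> complex_lines" for L
  proof -
    obtain u where u: "norm u = 1" "L = line u" by (rule complex_lines_cases[OF L])
    then have "U *v u \<noteq> 0" using norm_unitary[OF U, of u] by auto
    then show ?thesis unfolding u(2) image_line by (rule line_in_complex_lines)
  qed
  then show "(\<lambda>L. (*v) U ` L) \<in> space grassmann_sigma \<rightarrow> complex_lines" by auto
  fix V :: "(complex ^ 'n) set set"
  assume "V \<in> {V. grassmann_open V}"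
  then have V: "V \<subseteq> complex_lines" "open (\<Union>V - {0})" by (auto simp: grassmann_open_def)
  have "continuous_on UNIV ((*v) U)"
    by (rule linear_continuous_on) (simp add: linear_linear)
  then have "open ((*v) U -` (\<Union>V - {0}))" using V(2) by (metis continuous_on_open_vimage open_UNIV Int_UNIV_right)
  also have "(*v) U -` (\<Union>V - {0}) = {z. z \<noteq> 0 \<and> (*v) U ` line z \<in> V}"
  proof (rule set_eqI)
    fix z
    show "z \<in> (*v) U -` (\<Union>V - {0}) \<longleftrightarrow> z \<in> {z. z \<noteq> 0 \<and> (*v) U ` line z \<in> V}"
      using Union_lines_iff[OF V(1), of "U *v z"] Uz[of z] by (cases "z = 0") (simp_all add: image_line)
  qed
  finally have "grassmann_open {L \<in> complex_lines. (*v) U ` L \<in> V}" by (rule grassmann_openI)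
  then have "{L \<in> complex_lines. (*v) U ` L \<in> V} \<in> sets grassmann_sigma" by (rule grassmann_open_in_sets)
  also have "{L \<in> complex_lines. (*v) U ` L \<in> V} = (\<lambda>L. (*v) U ` L) -` V \<inter> space grassmann_sigma" by auto
  finally show "(\<lambda>L. (*v) U ` L) -` V \<inter> space grassmann_sigma \<in> sets grassmann_sigma" .
qed

lemma lborel_distr_unitary:
  assumes "unitary U"
  shows "distr lborel borel ((*v) U) = lborel"
  by (rule lborel_distr_linear_isometry) (simp_all add: norm_unitary[OF assms])

text \<open>The line through a random point of the unit ball. Its invariance is inherited from
  Lebesgue measure, since unitary maps are linear isometries and preserve the ball.\<close>

definition ball_line_measure :: "(complex ^ 'n) set measure" where
  "ball_line_measure = distr (uniform_measure lborel (ball 0 1)) grassmann_sigma (\<lambda>z. line (direction z))"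

lemma measurable_line_direction' [measurable]:
  "(\<lambda>z. line (direction z)) \<in> measurable (uniform_measure lborel (ball 0 1)) grassmann_sigma"
  using measurable_line_direction by (simp add: measurable_def)

lemma unitary_invariant_prob_ball_line_measure: "unitary_invariant_prob (ball_line_measure :: (complex ^ 'n) set measure)"
  unfolding unitary_invariant_prob_def
proof (intro conjI allI impI)
  let ?B = "ball (0 :: complex ^ 'n) 1"
  have "prob_space (uniform_measure lborel ?B)"
    using emeasure_unit_ball by (intro prob_space_uniform_measure) auto
  then show "prob_space (ball_line_measure :: (complex ^ 'n) set measure)"
    unfolding ball_line_measure_def by (rule prob_space.prob_space_distr) measurable
  show "space (ball_line_measure :: (complex ^ 'n) set measure) = complex_lines"
    by (simp add: ball_line_measure_def)
  show "sets (ball_line_measure :: (complex ^ 'n) set measure) = sigma_sets complex_lines {V. grassmann_open V}"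
    by (simp add: ball_line_measure_def sets_grassmann_sigma)
  fix U :: "complex ^ 'n ^ 'n" and A :: "(complex ^ 'n) set set"
  assume U: "unitary U" and "A \<in> sets ball_line_measure"
  then have A: "A \<in> sets grassmann_sigma" by (simp add: ball_line_measure_def)
  have A_sub: "A \<subseteq> complex_lines" using sets.sets_into_space[OF A] by simp
  define H where "H = adjoint_mat U"
  have H: "unitary H" unfolding H_def by (rule unitary_adjoint[OF U])
  define A' where "A' = (\<lambda>L. (*v) U ` L) ` A"
  have UH: "(*v) U ` (*v) H ` L = L" "(*v) H ` (*v) U ` L = L" for L
    unfolding image_image H_def unitary_adjoint_cancel[OF U] by simp_all
  \<comment> \<open>Measurability is available for preimages, and the image under \<open>U\<close>
    is the preimage under its inverse \<open>H\<close>.\<close>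
  have A'_eq: "A' = (\<lambda>L. (*v) H ` L) -` A \<inter> space grassmann_sigma"
  proof (intro equalityI subsetI)
    fix L assume "L \<in> A'"
    then obtain L' where L': "L' \<in> A" "L = (*v) U ` L'" by (auto simp: A'_def)
    have "L \<in> complex_lines"
      using measurable_space[OF measurable_unitary_image[OF U], of L'] L' A_sub by auto
    then show "L \<in> (\<lambda>L. (*v) H ` L) -` A \<inter> space grassmann_sigma" using L' UH(2) by simp
  next
    fix L assume "L \<in> (\<lambda>L. (*v) H ` L) -` A \<inter> space grassmann_sigma"
    then have "(*v) H ` L \<in> A" by simp
    then have "(*v) U ` (*v) H ` L \<in> A'" unfolding A'_def by (rule imageI)
    then show "L \<in> A'" by (simp only: UH(1))
  qed
  have A': "A' \<in> sets grassmann_sigma"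
    unfolding A'_eq by (rule measurable_sets[OF measurable_unitary_image[OF H] A])
  define X where "X = (\<lambda>C. {z :: complex ^ 'n. line (direction z) \<in> C})"
  have X: "X C \<in> sets borel" if "C \<in> sets grassmann_sigma" for C
    using measurable_sets[OF measurable_line_direction that] by (simp add: X_def vimage_def)
  have E: "emeasure ball_line_measure C = emeasure lborel (?B \<inter> X C) / emeasure lborel ?B"
    if C: "C \<in> sets grassmann_sigma" for C
  proof -
    have "emeasure ball_line_measure C = emeasure (uniform_measure lborel ?B) (X C)"
      unfolding ball_line_measure_def using C
      by (subst emeasure_distr) (simp_all add: measurable_line_direction' X_def vimage_def)
    also have "\<dots> = emeasure lborel (?B \<inter> X C) / emeasure lborel ?B"
      using X[OF C] by (intro emeasure_uniform_measure) simp_all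
    finally show ?thesis .
  qed
  have meas_H [measurable]: "(*v) H \<in> borel_measurable borel"
    by (intro borel_measurable_continuous_onI linear_continuous_on) (simp add: linear_linear)
  have "emeasure lborel (?B \<inter> X A') = emeasure lborel ((*v) H -` (?B \<inter> X A))"
  proof (rule emeasure_eq_AE)
    show "AE z in lborel. z \<in> ?B \<inter> X A' \<longleftrightarrow> z \<in> (*v) H -` (?B \<inter> X A)"
      using AE_lborel_singleton[of 0]
    proof eventually_elim
      case (elim z)
      then have Hz: "H *v z \<noteq> 0" using norm_unitary[OF H, of z] by auto
      have "line z \<in> A' \<longleftrightarrow> line (H *v z) \<in> A"
        unfolding A'_eq using line_in_complex_lines[OF elim] by (simp add: image_line)
      then show ?case
        by (simp add: X_def line_direction[OF elim] line_direction[OF Hz] norm_unitary[OF H])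
    qed
    show "?B \<inter> X A' \<in> sets lborel" using X[OF A'] by simp
    have "(*v) H -` (?B \<inter> X A) \<inter> space borel \<in> sets borel"
      using X[OF A] by (intro measurable_sets[OF meas_H] sets.Int) simp_all
    then show "(*v) H -` (?B \<inter> X A) \<in> sets lborel" by simp
  qed
  also have "\<dots> = emeasure (distr lborel borel ((*v) H)) (?B \<inter> X A)"
    using X[OF A] by (subst emeasure_distr) simp_all
  finally have "emeasure lborel (?B \<inter> X A') = emeasure lborel (?B \<inter> X A)"
    by (simp add: lborel_distr_unitary[OF H])
  then show "emeasure ball_line_measure ((\<lambda>L. (*v) U ` L) ` A) = emeasure ball_line_measure A"
    using E[OF A] E[OF A'] by (simp add: A'_def)
qed

theorem grassmann_measure_eq: "grassmann_measure = (ball_line_measure :: (complex ^ 'n) set measure)"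
  unfolding grassmann_measure_def
proof (rule the_equality)
  show "unitary_invariant_prob ball_line_measure" by (rule unitary_invariant_prob_ball_line_measure)
next
  fix M :: "(complex ^ 'n) set measure"
  assume "unitary_invariant_prob M"
  then show "M = ball_line_measure"
    by (rule unitary_invariant_prob_unique[OF _ unitary_invariant_prob_ball_line_measure])
qed

lemma nn_integral_grassmann_measure:
  fixes F :: "(complex ^ 'n) set \<Rightarrow> ennreal"
  assumes F: "F \<in> borel_measurable grassmann_sigma"
  shows "(\<integral>\<^sup>+L. F L \<partial>grassmann_measure)
    = (\<integral>\<^sup>+z. indicator (ball 0 1) z * F (line (direction z)) \<partial>lborel) / emeasure lborel (ball (0 :: complex ^ 'n) 1)"
proof -
  have "(\<integral>\<^sup>+L. F L \<partial>grassmann_measure) = (\<integral>\<^sup>+z. F (line (direction z)) \<partial>uniform_measure lborel (ball 0 1))"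
    unfolding grassmann_measure_eq ball_line_measure_def
    using F measurable_line_direction' by (intro nn_integral_distr) simp_all
  also have "\<dots> = (\<integral>\<^sup>+z. F (line (direction z)) * indicator (ball 0 1) z \<partial>lborel) / emeasure lborel (ball (0 :: complex ^ 'n) 1)"
    using measurable_compose[OF measurable_line_direction F] by (intro nn_integral_uniform_measure) simp_all
  finally show ?thesis by (simp add: mult.commute)
qed

section \<open>Section areas and their measurability in the line\<close>

definition section_area :: "(complex ^ 'n) set \<Rightarrow> complex ^ 'n \<Rightarrow> ennreal" where
  "section_area D u = emeasure lborel {c. c *s u \<in> D}"

lemma section_set_borel:
  assumes "D \<in> sets borel"
  shows "{c. c *s (u :: complex ^ 'n) \<in> D} \<in> sets borel"
proof -
  have "(\<lambda>c. c *s u) \<in> borel_measurable borel" by measurable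
  then have "(\<lambda>c. c *s u) -` D \<inter> space borel \<in> sets borel"
    using assms by (rule measurable_sets)
  then show ?thesis by (simp add: vimage_def)
qed

text \<open>The isometry \<open>f\<close> picked by \<open>SOME\<close> and the explicit one
  \<open>g\<close> differ by \<open>h\<close>, a linear isometry of the plane, which preserves
  Lebesgue measure. Linearity of \<open>h\<close> is verified after applying the injective map
  \<open>f\<close>.\<close>

lemma plane_area_line:
  fixes u :: "complex ^ 'n"
  assumes u: "norm u = 1" and D: "D \<in> sets borel"
  shows "plane_area (line u) (D \<inter> line u) = section_area D u"
proof -
  define g where "g = (\<lambda>c. c *s u)"
  have g: "linear g" "norm (g x) = norm x" "range g = line u" for x
    unfolding g_def using u by (simp_all add: linear_vector_smult_left norm_vector_smult line_def)
  define f :: "complex \<Rightarrow> complex ^ 'n" where "f = (SOME f. linear f \<and> (\<forall>x. norm (f x) = norm x) \<and> range f = line u)"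
  have "linear f \<and> (\<forall>x. norm (f x) = norm x) \<and> range f = line u"
    unfolding f_def by (rule someI[of "\<lambda>f. linear f \<and> (\<forall>x. norm (f x) = norm x) \<and> range f = line u" g]) (simp add: g)
  then have f: "linear f" "\<And>x. norm (f x) = norm x" "range f = line u" by auto
  have inj: "x = y" if "f x = f y" for x y
  proof -
    have "norm (x - y) = 0" using f(2)[of "x - y"] that by (simp add: linear_diff[OF f(1)])
    then show ?thesis by simp
  qed
  define h where "h = (\<lambda>c. inv f (g c))"
  have fh: "f (h c) = g c" for c
    unfolding h_def by (rule f_inv_into_f) (simp add: f(3) g(3)[symmetric])
  have "linear h"
    by (rule linearI; rule inj) (simp_all add: fh linear_add[OF f(1)] linear_scale[OF f(1)] linear_add[OF g(1)] linear_scale[OF g(1)])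
  moreover have nh: "norm (h c) = norm c" for c using f(2)[of "h c"] by (simp add: fh g(2))
  ultimately have dh: "distr lborel borel h = lborel" by (rule lborel_distr_linear_isometry)
  have [measurable]: "h \<in> borel_measurable borel" "f \<in> borel_measurable borel"
    using \<open>linear h\<close> f(1) by (auto intro!: borel_measurable_continuous_onI linear_continuous_on simp: linear_conv_bounded_linear)
  have fD: "f -` D \<in> sets borel"
    using measurable_sets[of f borel borel D] D by simp
  have "plane_area (line u) (D \<inter> line u) = emeasure lborel (f -` (D \<inter> line u))"
    by (simp add: plane_area_def f_def)
  also have "f -` (D \<inter> line u) = f -` D" using f(3) by auto
  also have "emeasure lborel (f -` D) = emeasure (distr lborel borel h) (f -` D)" by (simp add: dh)
  also have "\<dots> = emeasure lborel (h -` (f -` D))"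
    using fD by (subst emeasure_distr) simp_all
  also have "h -` (f -` D) = {c. c *s u \<in> D}"
    by (auto simp: fh g_def)
  finally show ?thesis by (simp add: section_area_def)
qed

text \<open>Lower semicontinuity: the indicator of an open set has it, and Fatou's lemma carries it
  over to the integral. Openness is what is needed, since the sigma algebra on lines is generated by
  open sets.\<close>

lemma open_section_area_greater:
  fixes D :: "(complex ^ 'n) set"
  assumes D: "open D"
  shows "open {u. y < section_area D u}"
proof -
  have "closed {u. section_area D u \<le> y}"
    unfolding closed_sequential_limits
  proof (intro allI impI, elim conjE)
    fix x :: "nat \<Rightarrow> complex ^ 'n" and l
    assume x: "\<forall>n. x n \<in> {u. section_area D u \<le> y}" and lim: "x \<longlonglongrightarrow> l"
    have Db [measurable]: "D \<in> sets borel" using D by simp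
    have ind: "section_area D u = (\<integral>\<^sup>+c. indicator D (c *s u) \<partial>lborel)" for u
    proof -
      have "section_area D u = (\<integral>\<^sup>+c. indicator {c. c *s u \<in> D} c \<partial>lborel)"
        unfolding section_area_def using section_set_borel[OF Db, of u] by simp
      then show ?thesis by (simp add: indicator_def)
    qed
    have "section_area D l \<le> (\<integral>\<^sup>+c. liminf (\<lambda>n. indicator D (c *s x n)) \<partial>lborel)"
      unfolding ind
    proof (rule nn_integral_mono)
      fix c :: complex
      show "indicator D (c *s l) \<le> liminf (\<lambda>n. indicator D (c *s x n) :: ennreal)"
      proof (cases "c *s l \<in> D")
        case True
        have "(\<lambda>n. c *s x n) \<longlonglongrightarrow> c *s l"
          using lim unfolding vector_scalar_mult_def by (intro tendsto_intros)
        then have "eventually (\<lambda>n. c *s x n \<in> D) sequentially"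
          using D True by (rule topological_tendstoD)
        then have "eventually (\<lambda>n. indicator D (c *s l) \<le> (indicator D (c *s x n) :: ennreal)) sequentially"
          by eventually_elim (simp add: True)
        then show ?thesis by (rule Liminf_bounded)
      qed simp
    qed
    also have "\<dots> \<le> liminf (\<lambda>n. \<integral>\<^sup>+c. indicator D (c *s x n) \<partial>lborel)"
      by (rule nn_integral_liminf) measurable
    also have "\<dots> \<le> liminf (\<lambda>n. y)"
      using x by (intro Liminf_mono always_eventually) (simp add: ind)
    also have "\<dots> = y" by (simp add: Liminf_const)
    finally show "l \<in> {u. section_area D u \<le> y}" by simp
  qed
  then have "open (- {u. section_area D u \<le> y})" by (simp add: open_Compl)
  also have "- {u. section_area D u \<le> y} = {u. y < section_area D u}" by auto
  finally show ?thesis .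
qed

lemma measurable_plane_area:
  fixes D :: "(complex ^ 'n) set"
  assumes D: "open D"
  shows "(\<lambda>L. plane_area L (D \<inter> L)) \<in> borel_measurable grassmann_sigma"
proof (rule borel_measurableI_greater)
  fix y
  have eq: "plane_area (line z) (D \<inter> line z) = section_area D (sgn z)" if "z \<noteq> 0" for z
    using plane_area_line[of "sgn z" D] D that by (simp add: norm_sgn line_sgn)
  have "open ((\<lambda>z. sgn z) -` {u. y < section_area D u} \<inter> (- {0 :: complex ^ 'n}))"
    using open_section_area_greater[OF D]
    by (intro continuous_on_open_vimage[THEN iffD1, rule_format])
      (auto simp: sgn_div_norm intro!: continuous_intros)
  also have "(\<lambda>z. sgn z) -` {u. y < section_area D u} \<inter> (- {0 :: complex ^ 'n})
     = {z. z \<noteq> 0 \<and> y < plane_area (line z) (D \<inter> line z)}"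
    by (auto simp: eq)
  finally have "grassmann_open {L \<in> complex_lines. y < plane_area L (D \<inter> L)}" by (rule grassmann_openI)
  then show "{L \<in> space grassmann_sigma. y < plane_area L (D \<inter> L)} \<in> sets grassmann_sigma"
    by (simp add: grassmann_open_in_sets)
qed

subsection \<open>Volume and section areas\<close>

definition complex_section :: "(complex ^ 'n) set \<Rightarrow> complex ^ 'n \<Rightarrow> complex set" where
  "complex_section D z = {c. c *s sgn z \<in> D}"

definition mean_area_power :: "(complex ^ 'n) set \<Rightarrow> ennreal" where
  "mean_area_power D = ennreal (1 / fact CARD('n)) *
     (\<integral>\<^sup>+L. plane_area L (D \<inter> L) ^ CARD('n) \<partial>grassmann_measure)"

lemma measurable_sgn_vec [measurable]: "(sgn :: complex ^ 'n \<Rightarrow> _) \<in> borel_measurable borel"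
  unfolding sgn_div_norm by measurable

lemma complex_section_borel [measurable]: "D \<in> sets borel \<Longrightarrow> complex_section D z \<in> sets borel"
  unfolding complex_section_def by (rule section_set_borel)

lemma weighted_area_complex_section:
  "weighted_area n (complex_section D z)
    = (\<integral>\<^sup>+c. ennreal (norm c ^ (2 * n - 2)) * indicator D (c *s sgn z) \<partial>lborel)"
  by (simp add: weighted_area_def complex_section_def indicator_def)

lemma measurable_weighted_area_section:
  assumes [measurable]: "D \<in> sets borel"
  shows "(\<lambda>z. weighted_area n (complex_section D z)) \<in> borel_measurable borel"
  unfolding weighted_area_complex_section by measurable

lemma emeasure_complex_section:
  assumes "D \<in> sets borel"
  shows "emeasure lborel (complex_section D z) = (\<integral>\<^sup>+c. indicator D (c *s sgn z) \<partial>lborel)"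
proof -
  have "indicator D (c *s sgn z) = (indicator (complex_section D z) c :: ennreal)" for c
    by (simp add: complex_section_def indicator_def)
  then show ?thesis using complex_section_borel[OF assms, of z] by simp
qed

lemma measurable_area_section:
  assumes [measurable]: "D \<in> sets borel"
  shows "(\<lambda>z. emeasure lborel (complex_section D z)) \<in> borel_measurable borel"
  unfolding emeasure_complex_section[OF assms] by measurable

lemma card_pos: "CARD('n::finite) \<ge> 1"
  by (simp add: Suc_leI)

lemma volume_by_sections:
  fixes D :: "(complex ^ 'n) set"
  assumes D: "D \<in> sets borel"
  shows "weighted_area CARD('n) (ball 0 1) * emeasure lborel D
    = (\<integral>\<^sup>+z. indicator (ball 0 1) z * weighted_area CARD('n) (complex_section D z) \<partial>lborel)"
  using nn_integral_complex_lines[of "indicator D"] D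
  by (simp add: weighted_area_complex_section)

text \<open>Averaging over the ball divides by its volume pi^n / n!; with the prefactor 1 / n! this
  leaves (1 / pi)^n. The result has the shape of \<open>volume_by_sections\<close>, and the
  integrands are the two sides of \<open>weighted_area_bathtub\<close>.\<close>

lemma mean_area_power_by_sections:
  fixes D :: "(complex ^ 'n) set"
  assumes D: "open D"
  shows "weighted_area CARD('n) (ball 0 1) * mean_area_power D
    = (\<integral>\<^sup>+z. indicator (ball 0 1) z * (weighted_area CARD('n) (ball 0 1) *
        (ennreal (1 / pi) * emeasure lborel (complex_section D z)) ^ CARD('n)) \<partial>lborel)"
proof -
  let ?n = "CARD('n)" and ?B = "ball (0 :: complex ^ 'n) 1"
  have Db [measurable]: "D \<in> sets borel" using D by simp
  note [measurable] = measurable_area_section[OF Db]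
  define I where "I = (\<integral>\<^sup>+z. indicator ?B z * emeasure lborel (complex_section D z) ^ ?n \<partial>lborel)"
  have "(\<integral>\<^sup>+L. plane_area L (D \<inter> L) ^ ?n \<partial>grassmann_measure)
     = (\<integral>\<^sup>+z. indicator ?B z * plane_area (line (direction z)) (D \<inter> line (direction z)) ^ ?n \<partial>lborel) / emeasure lborel ?B"
    by (rule nn_integral_grassmann_measure) (intro borel_measurable_power_ennreal measurable_plane_area D)
  also have "(\<integral>\<^sup>+z. indicator ?B z * plane_area (line (direction z)) (D \<inter> line (direction z)) ^ ?n \<partial>lborel) = I"
    unfolding I_def
  proof (rule nn_integral_cong_AE)
    show "AE z in lborel. indicator ?B z * plane_area (line (direction z)) (D \<inter> line (direction z)) ^ ?n
        = indicator ?B z * emeasure lborel (complex_section D z) ^ ?n"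
      using AE_lborel_singleton[of 0]
    proof eventually_elim
      case (elim z)
      then show ?case
        by (simp add: plane_area_line[OF norm_direction Db] section_area_def complex_section_def)
          (simp add: direction_def)
    qed
  qed
  finally have 1: "mean_area_power D = ennreal (1 / fact ?n) * (I / emeasure lborel ?B)"
    by (simp add: mean_area_power_def)
  have vol: "emeasure lborel ?B = ennreal (pi ^ ?n / fact ?n)"
    using unit_ball_vol_even[of ?n] by (simp add: emeasure_ball mult.commute)
  have "mean_area_power D = I * (ennreal (1 / fact ?n) * ennreal (inverse (pi ^ ?n / fact ?n)))"
    unfolding 1 vol divide_ennreal_def by (subst inverse_ennreal) (simp_all add: mult_ac)
  also have "ennreal (1 / fact ?n) * ennreal (inverse (pi ^ ?n / fact ?n)) = ennreal (1 / pi) ^ ?n"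
    by (simp add: ennreal_power power_divide flip: ennreal_mult)
  finally have 2: "mean_area_power D = I * ennreal (1 / pi) ^ ?n" .
  have "(\<integral>\<^sup>+z. indicator ?B z * (weighted_area ?n (ball 0 1) *
        (ennreal (1 / pi) * emeasure lborel (complex_section D z)) ^ ?n) \<partial>lborel)
     = (\<integral>\<^sup>+z. weighted_area ?n (ball 0 1) * ennreal (1 / pi) ^ ?n * (indicator ?B z * emeasure lborel (complex_section D z) ^ ?n) \<partial>lborel)"
    by (simp add: power_mult_distrib mult_ac)
  also have "\<dots> = weighted_area ?n (ball 0 1) * ennreal (1 / pi) ^ ?n * I"
    unfolding I_def by (rule nn_integral_cmult) measurable
  finally show ?thesis unfolding 2 by (simp add: mult_ac)
qed

lemma weighted_unit_cancel:
  "weighted_area n (ball 0 1) * a \<le> weighted_area n (ball 0 1) * b \<longleftrightarrow> a \<le> b"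
  "weighted_area n (ball 0 1) * a = weighted_area n (ball 0 1) * b \<longleftrightarrow> a = b"
  using weighted_area_unit_ball[of n] by (auto simp: ennreal_mult_le_mult_iff ennreal_mult_cancel_left)

theorem mean_area_power_le_volume:
  fixes D :: "(complex ^ 'n) set"
  assumes D: "open D"
  shows "mean_area_power D \<le> emeasure lborel D"
proof -
  have Db: "D \<in> sets borel" using D by simp
  have "weighted_area CARD('n) (ball 0 1) * mean_area_power D \<le> weighted_area CARD('n) (ball 0 1) * emeasure lborel D"
    unfolding volume_by_sections[OF Db] mean_area_power_by_sections[OF D]
    by (intro nn_integral_mono mult_left_mono weighted_area_bathtub(1)[OF complex_section_borel[OF Db] card_pos]) simp
  then show ?thesis by (simp only: weighted_unit_cancel)
qed

section \<open>Equality for circular domains\<close>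

lemma open_complex_section: "open D \<Longrightarrow> open (complex_section D z)"
proof -
  assume "open D"
  moreover have "continuous_on UNIV (\<lambda>c. c *s sgn z)" by (intro continuous_intros)
  ultimately have "open ((\<lambda>c. c *s sgn z) -` D)" by (metis continuous_on_open_vimage open_UNIV Int_UNIV_right)
  then show ?thesis by (simp add: complex_section_def vimage_def)
qed

text \<open>The radius is the supremum of the moduli. Openness excludes that it is attained, because
  any point of \<open>E\<close> can be pushed outwards a little.\<close>

lemma open_balanced_is_disc:
  fixes E :: "complex set"
  assumes E: "open E" and bal: "\<And>c c'. c \<in> E \<Longrightarrow> norm c' \<le> norm c \<Longrightarrow> c' \<in> E"
  shows "E = UNIV \<or> (\<exists>r. E = ball 0 r)"
proof (cases "bdd_above (norm ` E)")
  case True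
  show ?thesis
  proof (cases "E = {}")
    case False
    have "E = ball 0 (Sup (norm ` E))"
    proof (intro equalityI subsetI)
      fix c assume c: "c \<in> E"
      then obtain e where e: "e > 0" "cball c e \<subseteq> E" using E by (meson open_contains_cball)
      \<comment> \<open>The unit vector pointing radially outwards at \<open>c\<close>; at the
        origin every direction does.\<close>
      define s where "s = (if c = 0 then 1 else sgn c)"
      have "c + of_real e * s \<in> E"
        using e by (intro subsetD[OF e(2)]) (simp add: dist_norm norm_mult s_def norm_sgn)
      then have "norm (c + of_real e * s) \<le> Sup (norm ` E)"
        using True by (intro cSup_upper imageI)
      moreover have "norm (c + of_real e * s) = norm c + e"
      proof (cases "c = 0")
        case False
        have "c + of_real e * s = of_real (norm c + e) * sgn c"
          using False by (simp add: s_def distrib_right sgn_div_norm scaleR_conv_of_real)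
        then show ?thesis using False e by (simp add: norm_mult norm_sgn del: of_real_add)
      qed (use e in \<open>simp add: s_def norm_mult\<close>)
      ultimately show "c \<in> ball 0 (Sup (norm ` E))" using e by simp
    next
      fix c :: complex assume "c \<in> ball 0 (Sup (norm ` E))"
      then have "norm c < Sup (norm ` E)" by simp
      then obtain c' where "c' \<in> E" "norm c < norm c'"
        using less_cSup_iff[of "norm ` E" "norm c"] True False by auto
      then show "c \<in> E" using bal by auto
    qed
    then show ?thesis by blast
  qed (auto intro: exI[of _ 0])
next
  case False
  have "c \<in> E" for c
  proof -
    obtain c' where "c' \<in> E" "norm c \<le> norm c'"
      using False by (force simp: bdd_above_def not_le intro: less_imp_le)
    then show ?thesis using bal by blast
  qed
  then show ?thesis by auto
qed

text \<open>A point of smaller modulus is reached by a rotation, allowed by circularity, followed by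
  a contraction towards the origin, allowed by star-shapedness.\<close>

lemma circular_section_disc:
  fixes D :: "(complex ^ 'n) set"
  assumes D: "open D" "star_shaped D" "circular D"
  shows "complex_section D z = UNIV \<or> (\<exists>r. complex_section D z = ball 0 r)"
proof (rule open_balanced_is_disc)
  show "open (complex_section D z)" by (rule open_complex_section[OF D(1)])
  fix c c' :: complex
  assume c: "c \<in> complex_section D z" and le: "norm c' \<le> norm c"
  define t where "t = norm c' / norm c"
  have t: "0 \<le> t" "t \<le> 1" using le by (auto simp: t_def divide_le_eq)
  define a where "a = Arg (c' / c)"
  have c': "c' = of_real t * (cis a * c)"
  proof (cases "c = 0")
    case False
    then have "c' = (c' / c) * c" by simp
    also have "c' / c = of_real t * cis a"
      unfolding t_def a_def using rcis_cmod_Arg[of "c' / c"] by (simp add: rcis_def norm_divide)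
    finally show ?thesis by (simp add: mult.assoc)
  qed (use le in simp)
  have "c *s sgn z \<in> D" using c by (simp add: complex_section_def)
  then have "cis a *s (c *s sgn z) \<in> D" using D(3) by (auto simp: circular_def)
  then have "t *\<^sub>R (cis a *s (c *s sgn z)) \<in> D" using D(2) t by (auto simp: star_shaped_def)
  then show "c' \<in> complex_section D z"
    by (simp add: complex_section_def c' vector_smult_assoc flip: vector_smult_of_real)
qed

lemma circular_equality:
  fixes D :: "(complex ^ 'n) set"
  assumes D: "open D" "star_shaped D" "circular D"
  shows "emeasure lborel D = mean_area_power D"
proof -
  have Db: "D \<in> sets borel" using D by simp
  have "weighted_area CARD('n) (ball 0 1) * emeasure lborel D = weighted_area CARD('n) (ball 0 1) * mean_area_power D"
    unfolding volume_by_sections[OF Db] mean_area_power_by_sections[OF D(1)]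
    by (simp only: weighted_area_disc[OF card_pos circular_section_disc[OF D]])
  then show ?thesis by (simp only: weighted_unit_cancel)
qed

section \<open>From equality to circularity up to null sets\<close>

lemma cis_image_eq: "(\<lambda>z. cis \<theta> *s z) ` D = {z. cis (- \<theta>) *s z \<in> D}"
proof (intro equalityI subsetI)
  fix z assume "z \<in> {z. cis (- \<theta>) *s z \<in> D}"
  then have "cis (- \<theta>) *s z \<in> D" by simp
  moreover have "z = cis \<theta> *s (cis (- \<theta>) *s z)" by (simp add: vector_smult_assoc cis_mult)
  ultimately show "z \<in> (\<lambda>z. cis \<theta> *s z) ` D" by blast
qed (auto simp: vector_smult_assoc cis_mult)

lemma cis_image_borel:
  fixes D :: "(complex ^ 'n) set"
  assumes "D \<in> sets borel"
  shows "(\<lambda>z. cis \<theta> *s z) ` D \<in> sets borel"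
proof -
  have "(\<lambda>z :: complex ^ 'n. cis (- \<theta>) *s z) \<in> borel_measurable borel" by measurable
  from measurable_sets[OF this assms] show ?thesis by (simp add: cis_image_eq vimage_def)
qed

lemma null_set_rotate:
  assumes "N \<in> null_sets (lborel :: complex measure)"
  shows "{c. cis a * c \<in> N} \<in> null_sets lborel"
proof -
  have N: "N \<in> sets borel" using assms by auto
  have m: "(\<lambda>c. cis a * c) \<in> borel_measurable borel" by measurable
  have d: "distr lborel borel (\<lambda>c. cis a * c) = lborel"
    by (rule lborel_distr_linear_isometry)
      (simp_all add: bounded_linear_mult_right bounded_linear.linear norm_mult)
  have "emeasure lborel ((\<lambda>c. cis a * c) -` N) = emeasure (distr lborel borel (\<lambda>c. cis a * c)) N"
    using m N by (subst emeasure_distr) simp_all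
  also have "\<dots> = 0" using assms unfolding d by auto
  finally show ?thesis using measurable_sets[OF m N] by (simp add: vimage_def null_setsI)
qed

text \<open>The volume formula applied to \<open>N\<close>: as the weight vanishes at most at the
  origin, weighted area and area have the same null sets.\<close>

lemma null_set_iff_sections:
  fixes N :: "(complex ^ 'n) set"
  assumes N: "N \<in> sets borel"
  shows "N \<in> null_sets lborel \<longleftrightarrow>
    (AE z in lborel. z \<in> ball 0 1 \<longrightarrow> complex_section N z \<in> null_sets lborel)"
proof -
  let ?n = "CARD('n)"
  have W: "weighted_area ?n (complex_section N z) = 0 \<longleftrightarrow> complex_section N z \<in> null_sets lborel" for z
  proof -
    have E: "complex_section N z \<in> sets borel" by (rule complex_section_borel[OF N])
    have "weighted_area ?n (complex_section N z) = 0 \<longleftrightarrow>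
        (AE c in lborel. ennreal (norm c ^ (2 * ?n - 2)) * indicator (complex_section N z) c = 0)"
      unfolding weighted_area_def using E by (intro nn_integral_0_iff_AE) simp
    also have "\<dots> \<longleftrightarrow> (AE c in lborel. c \<notin> complex_section N z)"
    proof (rule eventually_subst)
      show "AE c in lborel. (ennreal (norm c ^ (2 * ?n - 2)) * indicator (complex_section N z) c = 0) \<longleftrightarrow> c \<notin> complex_section N z"
        using AE_lborel_singleton[of 0] by eventually_elim (auto simp: indicator_def)
    qed
    also have "\<dots> \<longleftrightarrow> complex_section N z \<in> null_sets lborel"
      using E by (subst AE_iff_null_sets) simp_all
    finally show ?thesis .
  qed
  have "N \<in> null_sets lborel \<longleftrightarrow> weighted_area ?n (ball 0 1) * emeasure lborel N = 0"
    using N weighted_area_unit_ball[of ?n] by (auto simp: null_sets_def)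
  also have "\<dots> \<longleftrightarrow> (AE z in lborel. indicator (ball 0 1) z * weighted_area ?n (complex_section N z) = 0)"
    unfolding volume_by_sections[OF N] using measurable_weighted_area_section[OF N]
    by (intro nn_integral_0_iff_AE) simp
  also have "\<dots> \<longleftrightarrow> (AE z in lborel. z \<in> ball 0 1 \<longrightarrow> complex_section N z \<in> null_sets lborel)"
    unfolding W[symmetric] by (simp add: indicator_def)
  finally show ?thesis .
qed

text \<open>Equal finite integrals of ordered integrands force equality in the bathtub inequality on
  almost every line, so almost every section is a disc up to a null set. The radius may depend on
  the line, which rotations do not change.\<close>

lemma equality_imp_circular_ae:
  fixes D :: "(complex ^ 'n) set"
  assumes D: "open D" and n: "CARD('n) \<ge> 2" and fin: "emeasure lborel D \<noteq> \<infinity>"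
    and eq: "emeasure lborel D = mean_area_power D"
  shows "circular_ae D"
  unfolding circular_ae_def
proof
  fix \<theta>
  let ?n = "CARD('n)"
  have Db: "D \<in> sets borel" using D by simp
  note [measurable] = measurable_weighted_area_section[OF Db] measurable_area_section[OF Db]
  let ?W = "\<lambda>z. weighted_area ?n (complex_section D z)"
  let ?A = "\<lambda>z. weighted_area ?n (ball 0 1) * (ennreal (1 / pi) * emeasure lborel (complex_section D z)) ^ ?n"
  have W_fin: "(\<integral>\<^sup>+z. indicator (ball 0 1) z * ?W z \<partial>lborel) \<noteq> \<infinity>"
    unfolding volume_by_sections[OF Db, symmetric]
    using fin weighted_area_unit_ball[of ?n] by (simp add: ennreal_mult_eq_top_iff)
  have "AE z in lborel. indicator (ball 0 1) z * ?A z = indicator (ball 0 1) z * ?W z"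
  proof (rule AE_eq_if_nn_integral_eq)
    show "indicator (ball 0 1) z * ?A z \<le> indicator (ball 0 1) z * ?W z" for z
      by (intro mult_left_mono weighted_area_bathtub(1)[OF complex_section_borel[OF Db] card_pos]) simp
    show "(\<integral>\<^sup>+z. indicator (ball 0 1) z * ?A z \<partial>lborel) = (\<integral>\<^sup>+z. indicator (ball 0 1) z * ?W z \<partial>lborel)"
      unfolding volume_by_sections[OF Db, symmetric] mean_area_power_by_sections[OF D, symmetric] eq ..
  qed (use W_fin in \<open>simp_all\<close>)
  moreover have "AE z in lborel. indicator (ball 0 1) z * ?W z \<noteq> \<infinity>"
    using W_fin by (intro nn_integral_PInf_AE) simp_all
  ultimately have "AE z in lborel. z \<in> ball 0 1 \<longrightarrow> (\<exists>r. sym_diff (complex_section D z) (ball 0 r) \<in> null_sets lborel)"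
  proof eventually_elim
    case (elim z)
    show ?case
    proof
      assume "z \<in> ball 0 1"
      with elim have "?A z = ?W z" "?W z \<noteq> \<infinity>" by simp_all
      then show "\<exists>r. sym_diff (complex_section D z) (ball 0 r) \<in> null_sets lborel"
        using weighted_area_bathtub(2)[OF complex_section_borel[OF Db] card_pos n] by blast
    qed
  qed
  then have "AE z in lborel. z \<in> ball 0 1 \<longrightarrow>
      complex_section (sym_diff D ((\<lambda>z. cis \<theta> *s z) ` D)) z \<in> null_sets lborel"
  proof eventually_elim
    case (elim z)
    show ?case
    proof
      assume "z \<in> ball 0 1"
      with elim obtain r where r: "sym_diff (complex_section D z) (ball 0 r) \<in> null_sets lborel" (is "?N \<in> _")
        by blast
      \<comment> \<open>A centred disc is rotation invariant, so where \<open>D\<close> and its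
        rotation disagree, the section must differ from the disc at \<open>c\<close> or at the
        rotated point.\<close>
      have "complex_section (sym_diff D ((\<lambda>z. cis \<theta> *s z) ` D)) z \<subseteq> ?N \<union> {c. cis (- \<theta>) * c \<in> ?N}"
        by (auto simp: complex_section_def cis_image_eq vector_smult_assoc norm_mult)
      moreover have "?N \<union> {c. cis (- \<theta>) * c \<in> ?N} \<in> null_sets lborel"
        using r null_set_rotate[OF r] by (rule null_sets.Un)
      moreover have "complex_section (sym_diff D ((\<lambda>z. cis \<theta> *s z) ` D)) z \<in> sets lborel"
        using complex_section_borel[of "sym_diff D ((\<lambda>z. cis \<theta> *s z) ` D)" z] Db cis_image_borel[OF Db]
        by (simp add: sets.Un sets.Diff)
      ultimately show "complex_section (sym_diff D ((\<lambda>z. cis \<theta> *s z) ` D)) z \<in> null_sets lborel"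
        by (metis null_sets_subset)
    qed
  qed
  then show "sym_diff D ((\<lambda>z. cis \<theta> *s z) ` D) \<in> null_sets lborel"
    using Db cis_image_borel[OF Db] by (subst null_set_iff_sections) (simp_all add: sets.Un sets.Diff)
qed

section \<open>From circularity up to null sets back to equality\<close>

lemma continuous_on_cis_smult: "continuous_on UNIV (\<lambda>t. cis t *s z)"
  by (intro continuous_intros)

text \<open>\<open>D'\<close> is the union of the rotations of \<open>D\<close> by rational angles: a countable
  union, but open, hence invariant under all rotations.\<close>

lemma circular_ae_hull:
  fixes D :: "(complex ^ 'n) set"
  assumes D: "open D" "star_shaped D" and ae: "circular_ae D"
  obtains D' where "open D'" "star_shaped D'" "circular D'" "D \<subseteq> D'" "D' - D \<in> null_sets lborel"
proof
  define D' where "D' = (\<Union>q\<in>\<rat>. {z. cis q *s z \<in> D})"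
  have open_rot: "open {z. cis q *s z \<in> D}" for q
  proof -
    have "continuous_on UNIV (\<lambda>z :: complex ^ 'n. cis q *s z)" by (intro continuous_intros)
    then have "open ((\<lambda>z. cis q *s z) -` D)"
      using D(1) by (metis continuous_on_open_vimage open_UNIV Int_UNIV_right)
    then show ?thesis by (simp add: vimage_def)
  qed
  show "open D'" unfolding D'_def using open_rot by auto
  show "star_shaped D'"
    unfolding star_shaped_def
  proof (intro ballI)
    fix z and t :: real
    assume "z \<in> D'" and t: "t \<in> {0..1}"
    then obtain q where q: "q \<in> \<rat>" "cis q *s z \<in> D" by (auto simp: D'_def)
    have "t *\<^sub>R (cis q *s z) \<in> D" using D(2) q(2) t by (auto simp: star_shaped_def)
    then have "cis q *s (t *\<^sub>R z) \<in> D"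
      by (simp add: vector_smult_assoc mult.commute flip: vector_smult_of_real)
    then show "t *\<^sub>R z \<in> D'" using q(1) by (auto simp: D'_def)
  qed
  show "D \<subseteq> D'" by (auto simp: D'_def intro!: bexI[of _ 0])
  show "circular D'"
    unfolding circular_def
  proof (intro ballI allI)
    fix z \<theta>
    assume "z \<in> D'"
    then obtain q where q: "cis q *s z \<in> D" by (auto simp: D'_def)
    have "open ((\<lambda>t. cis t *s z) -` D)"
      using D(1) continuous_on_cis_smult[of z] by (metis continuous_on_open_vimage open_UNIV Int_UNIV_right)
    then obtain e where e: "e > 0" "ball q e \<subseteq> (\<lambda>t. cis t *s z) -` D"
      using q by (metis open_contains_ball vimageI)
    \<comment> \<open>All angles near \<open>q\<close> rotate \<open>z\<close> into
      \<open>D\<close>, so it suffices that \<open>p\<close> is rational and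
      \<open>p + \<theta>\<close> lies slightly above \<open>q\<close>.\<close>
    obtain p where p: "p \<in> \<rat>" "q - \<theta> < p" "p < q - \<theta> + e"
      using Rats_dense_in_real[of "q - \<theta>" "q - \<theta> + e"] e by auto
    then have "p + \<theta> \<in> ball q e" by (simp add: dist_real_def abs_if)
    then have "cis (p + \<theta>) *s z \<in> D" using e(2) by auto
    then have "cis p *s (cis \<theta> *s z) \<in> D" by (simp add: vector_smult_assoc cis_mult)
    then show "cis \<theta> *s z \<in> D'" using p(1) by (auto simp: D'_def)
  qed
  have "{z. cis q *s z \<in> D} - D \<in> null_sets lborel" for q
  proof (rule null_sets_subset)
    show "sym_diff D ((\<lambda>z. cis (- q) *s z) ` D) \<in> null_sets lborel"
      using ae unfolding circular_ae_def by blast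
    show "{z. cis q *s z \<in> D} - D \<in> sets lborel" using open_rot[of q] D(1) by simp
    show "{z. cis q *s z \<in> D} - D \<subseteq> sym_diff D ((\<lambda>z. cis (- q) *s z) ` D)"
      by (auto simp: cis_image_eq)
  qed
  then have "(\<Union>q\<in>\<rat>. {z. cis q *s z \<in> D} - D) \<in> null_sets lborel"
    by (intro null_sets_UN' countable_rat)
  then show "D' - D \<in> null_sets lborel" by (simp add: D'_def)
qed

lemma emeasure_eq_if_diff_null:
  fixes X Y :: "'a::euclidean_space set"
  assumes "X \<subseteq> Y" "Y - X \<in> null_sets lborel" "X \<in> sets borel"
  shows "emeasure lborel X = emeasure lborel Y"
proof -
  have "emeasure lborel (X \<union> (Y - X)) = emeasure lborel X"
    using assms by (intro emeasure_Un_null_set) simp_all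
  then show ?thesis using assms(1) by (simp add: Un_absorb1)
qed

text \<open>Passing to the circular hull changes neither the volume nor, by
  \<open>null_set_iff_sections\<close>, the area of almost every section, and for the hull equality
  is known.\<close>

lemma circular_ae_imp_equality:
  fixes D :: "(complex ^ 'n) set"
  assumes D: "open D" "star_shaped D" and ae: "circular_ae D"
  shows "emeasure lborel D = mean_area_power D"
proof -
  let ?n = "CARD('n)"
  obtain D' where D': "open D'" "star_shaped D'" "circular D'" "D \<subseteq> D'" "D' - D \<in> null_sets lborel"
    using D ae by (rule circular_ae_hull)
  have Db: "D \<in> sets borel" "D' \<in> sets borel" using D D' by simp_all
  have "AE z in lborel. z \<in> ball 0 1 \<longrightarrow> complex_section (D' - D) z \<in> null_sets lborel"
    using D'(5) Db by (subst (asm) null_set_iff_sections) simp_all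
  then have "AE z in lborel. z \<in> ball 0 1 \<longrightarrow>
      emeasure lborel (complex_section D z) = emeasure lborel (complex_section D' z)"
  proof eventually_elim
    case (elim z)
    have "complex_section D z \<subseteq> complex_section D' z"
      "complex_section D' z - complex_section D z = complex_section (D' - D) z"
      using D'(4) by (auto simp: complex_section_def)
    then show ?case
      using elim emeasure_eq_if_diff_null[OF _ _ complex_section_borel[OF Db(1)]] by metis
  qed
  then have "weighted_area ?n (ball 0 1) * mean_area_power D = weighted_area ?n (ball 0 1) * mean_area_power D'"
    unfolding mean_area_power_by_sections[OF D(1)] mean_area_power_by_sections[OF D'(1)]
    by (intro nn_integral_cong_AE, eventually_elim) (simp add: indicator_def)
  then have "mean_area_power D = mean_area_power D'" by (simp only: weighted_unit_cancel)
  also have "\<dots> = emeasure lborel D'" by (rule circular_equality[OF D'(1-3), symmetric])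
  also have "\<dots> = emeasure lborel D" by (rule emeasure_eq_if_diff_null[OF D'(4,5) Db(1), symmetric])
  finally show ?thesis ..
qed

section \<open>Circularity of domains that are the interior of their closure\<close>

lemma open_null_set_empty:
  fixes S :: "'a::euclidean_space set"
  assumes "open S" "S \<in> null_sets lborel"
  shows "S = {}"
proof (rule ccontr)
  assume "S \<noteq> {}"
  then obtain x e where e: "e > 0" "ball x e \<subseteq> S" using assms(1) by (meson equals0I open_contains_ball)
  then have "ball x e \<in> null_sets lborel" using assms(2) by (intro null_sets_subset[OF assms(2)]) simp_all
  then have "emeasure lborel (ball x e) = 0" by auto
  moreover have "unit_ball_vol (real DIM('a)) * e ^ DIM('a) > 0"
    using e(1) by (intro mult_pos_pos zero_less_power unit_ball_vol_pos) simp_all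
  ultimately show False using e(1) by (simp add: emeasure_ball ennreal_eq_0_iff)
qed

text \<open>The part of a rotated copy outside \<open>closure D\<close> is open and null, hence
  empty. The open copy then lies in the interior of the closure, which is \<open>D\<close>.\<close>

lemma circular_ae_imp_circular:
  fixes D :: "(complex ^ 'n) set"
  assumes D: "interior (closure D) = D" and ae: "circular_ae D"
  shows "circular D"
  unfolding circular_def
proof (intro ballI allI)
  fix z \<theta>
  assume z: "z \<in> D"
  define D' where "D' = (\<lambda>z. cis \<theta> *s z) ` D"
  have "open D" using D by (metis open_interior)
  have "continuous_on UNIV (\<lambda>z :: complex ^ 'n. cis (- \<theta>) *s z)" by (intro continuous_intros)
  then have "open ((\<lambda>z. cis (- \<theta>) *s z) -` D)"
    using \<open>open D\<close> by (metis continuous_on_open_vimage open_UNIV Int_UNIV_right)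
  then have "open D'" by (simp add: D'_def cis_image_eq vimage_def)
  then have o: "open (D' - closure D)" by (rule open_Diff) simp
  moreover have "D' - closure D \<in> null_sets lborel"
  proof (rule null_sets_subset)
    show "sym_diff D D' \<in> null_sets lborel" using ae by (simp add: circular_ae_def D'_def)
    show "D' - closure D \<in> sets lborel" using o by simp
    show "D' - closure D \<subseteq> sym_diff D D'" using closure_subset by blast
  qed
  ultimately have "D' - closure D = {}" by (rule open_null_set_empty)
  then have "D' \<subseteq> interior (closure D)" using \<open>open D'\<close> by (intro interior_maximal) auto
  then show "cis \<theta> *s z \<in> D" using z by (auto simp: D D'_def)
qed

theorem theorem1:
  fixes D :: "(complex ^ 'n) set"
  assumes "complex_domain D" and "star_shaped D" and "origin_symmetric D"
  shows
    "let vol = emeasure lborel D;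
         rhs = ennreal (1 / fact CARD('n)) *
           (\<integral>\<^sup>+ L. plane_area L (D \<inter> L) ^ CARD('n) \<partial>grassmann_measure)
     in vol \<ge> rhs \<and>
        (circular D \<longrightarrow> vol = rhs) \<and>
        (2 \<le> CARD('n) \<longrightarrow> vol < \<infinity> \<longrightarrow>
           (vol = rhs \<longleftrightarrow> circular_ae D) \<and>
           (interior (closure D) = D \<longrightarrow> (vol = rhs \<longleftrightarrow> circular D)))"
proof -
  have D: "open D" "star_shaped D" using assms by (simp_all add: complex_domain_def)
  show ?thesis
    unfolding Let_def mean_area_power_def[symmetric]
    using mean_area_power_le_volume[OF D(1)] circular_equality[OF D]
      equality_imp_circular_ae[OF D(1)] circular_ae_imp_equality[OF D]
      circular_ae_imp_circular[of D]
    by (metis less_irrefl infinity_ennreal_def)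
qed

end
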